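(* Let $\{\lambda_n\}_{n=1}^\infty$ be an admissible scale and let $\nu>-1$. For $v\in\mathbb{R}$ and $n\ge1$ put $z=e^{2\pi v}$, $q=e^{-\pi\lambda_n^{-1}}$. Then, as $n\to\infty$, $$J_\nu^{(2)}\left(2i\sqrt{zq^{-\nu}}\,q^{-2n};q\right)=\frac{\exp\left(\frac{\pi\lambda_n}{3}-\frac{\pi}{12\lambda_n}+\frac{\nu^2\pi}{4\lambda_n}+\frac{\nu\pi i}{2}\right)}{2\sqrt{\lambda_n}}\exp\left\{\pi\lambda_n\left(v+\frac{4n+\nu}{2\lambda_n}\right)^2\right\}\left\{1+\mathcal{O}\left(e^{-\pi\lambda_n}\right)\right\}$$ and $$J_\nu^{(2)}\left(2\sqrt{zq^{-\nu}}\,q^{-2n};q\right)=\frac{\exp\left(\frac{\pi\lambda_n}{12}-\frac{\pi}{12\lambda_n}+\frac{\nu^2\pi}{4\lambda_n}\right)}{\sqrt{\lambda_n}}\exp\left\{\pi\lambda_n\left(v+\frac{4n+\nu}{2\lambda_n}\right)^2\right\}\left\{\cos\pi\lambda_n v+\mathcal{O}\left(e^{-2\pi\lambda_n}\right)\right\},$$ where the $\mathcal{O}$-terms are uniform for $v$ in any compact subset of $\mathbb{R}$.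
   Context: An admissible scale is a sequence $\{\lambda_n\}_{n=1}^\infty$ of positive numbers such that $\lim_{n\to\infty}\lambda_n/\log n=\infty$ and $\lim_{n\to\infty} n/\lambda_n^2=\infty$. For $0<q<1$, $(a;q)_\infty:=\prod_{k=0}^\infty(1-aq^k)$, $(a;q)_k:=(a;q)_\infty/(aq^k;q)_\infty$, and $(a,b;q)_k:=(a;q)_k(b;q)_k$. Jackson's $q$-Bessel function is, for $\nu>-1$, $$J_\nu^{(2)}(w;q):=\frac{(q^{\nu+1};q)_\infty}{(q;q)_\infty}\sum_{k=0}^\infty\frac{q^{k^2+k\nu}(-1)^k}{(q,q^{\nu+1};q)_k}\left(\frac{w}{2}\right)^{2k+\nu}.$$ Powers are taken with the principal branch (so $i^\nu=e^{\nu\pi i/2}$), and $\sqrt{zq^{-\nu}}$ is the positive square root. Note that $q$ depends on $n$. *)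

theory Defs
  imports "HOL-Complex_Analysis.Complex_Analysis"
begin

text \<open>Scales are indexed by \<open>n \<ge> 1\<close>; the value at \<open>0\<close> is irrelevant.\<close>

definition admissible_scale :: "(nat \<Rightarrow> real) \<Rightarrow> bool" where
  "admissible_scale lam \<longleftrightarrow>
     (\<forall>n\<ge>1. lam n > 0) \<and>
     filterlim (\<lambda>n. lam n / ln (real n)) at_top sequentially \<and>
     filterlim (\<lambda>n. real n / (lam n)\<^sup>2) at_top sequentially"

definition qpoch_inf :: "complex \<Rightarrow> real \<Rightarrow> complex" where
  "qpoch_inf a q = (\<Prod>k. 1 - a * of_real q ^ k)"

definition qpoch :: "complex \<Rightarrow> real \<Rightarrow> nat \<Rightarrow> complex" where
  "qpoch a q k = qpoch_inf a q / qpoch_inf (a * of_real q ^ k) q"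

text \<open>
  Jackson's second \<open>q\<close>-Bessel function, for \<open>0 < q < 1\<close>, \<open>\<nu> > -1\<close> and \<open>w \<noteq> 0\<close>. On complex
  numbers \<open>powr\<close> is the principal branch. The point \<open>w = 0\<close> is excluded because \<open>0 powr s = 0\<close>
  for every \<open>s\<close>, so that the \<open>k = 0\<close> term would be wrong there for \<open>\<nu> = 0\<close>.
\<close>

definition q_bessel2 :: "real \<Rightarrow> complex \<Rightarrow> real \<Rightarrow> complex" where
  "q_bessel2 \<nu> w q =
     qpoch_inf (of_real (q powr (\<nu> + 1))) q / qpoch_inf (of_real q) q *
     (\<Sum>k. of_real (q powr ((real k)\<^sup>2 + real k * \<nu>)) * (-1) ^ k
          / (qpoch (of_real q) q k * qpoch (of_real (q powr (\<nu> + 1))) q k)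
          * (w / 2) powr of_real (2 * real k + \<nu>))"

end

theory Submission
  imports Defs "HOL-Probability.Characteristic_Functions"
begin

text \<open>
  Write \<open>l\<close> for \<open>\<lambda>\<^sub>n\<close>, so that \<open>q = exp (- \<pi> / l)\<close>. With
  \<open>1 / (q, q\<^bsup>\<nu>+1\<^esup>; q)\<^sub>k\<close> written through infinite products, the Bessel series becomes
  a prefactor times \<open>(q;q)\<^sub>\<infinity>\<close> to the power \<open>-2\<close> times
  \<open>\<Sum>k\<ge>0. (\<plusminus>1)^k q^(k\<^sup>2 - 4nk) z^k A(k)\<close>, with weights
  \<open>A(k) = (q\<^bsup>k+1\<^esup>; q)\<^sub>\<infinity> (q\<^bsup>k+\<nu>+1\<^esup>; q)\<^sub>\<infinity>\<close> between \<open>0\<close> and \<open>1\<close>.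
  The terms peak near \<open>k = 2n\<close>. Putting \<open>k = 2n + j\<close> and completing the square in the exponent turns
  the sum into a power of \<open>q\<close> and \<open>z\<close> times the theta series \<open>\<Sum>j. (\<plusminus>1)^j q^(j\<^sup>2) z^j\<close>, cut off
  at \<open>j = -2n\<close> and weighted by \<open>A(2n + j)\<close>. For \<open>k \<ge> n\<close> the weight differs from \<open>1\<close> by at most
  \<open>2 q^n / (1 - q)\<close>, and the range \<open>k < n\<close> costs a factor \<open>exp (- 2 \<pi> n)\<close>
  (\<open>truncated_theta_sum\<close>). Since \<open>n\<close> is eventually larger than any multiple of \<open>l\<^sup>2\<close>, both errors are
  smaller than any prescribed exponential in \<open>l\<close> (\<open>bessel_sum_approx\<close>). This uses
  \<open>n / \<lambda>\<^sub>n\<^sup>2 \<rightarrow> \<infinity>\<close>, while \<open>\<lambda>\<^sub>n / log n \<rightarrow> \<infinity>\<close> makes \<open>l\<close> large, so that the explicit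
  bounds for \<open>l \<ge> 3/2\<close> below apply.

  What remains is modular. Poisson summation of a Gaussian (\<open>theta_transformation\<close>) exchanges \<open>l\<close>
  and \<open>1 / l\<close>: the theta series with slowly decaying terms becomes \<open>\<surd>l exp (\<pi> l v\<^sup>2)\<close> times a series
  with terms of size \<open>exp (- \<pi> l m\<^sup>2)\<close>, where \<open>m\<close> runs through the integers for the sign \<open>+\<close> and
  through the half-integers for the sign \<open>-\<close>. Its leading term is \<open>1\<close>, respectively
  \<open>2 exp (- \<pi> l / 4) cos (\<pi> l v)\<close>, and the following term gives the error of the corollary.

  The factor \<open>(q;q)\<^sub>\<infinity>\<close> is evaluated by the same transformation. Euler's pentagonal number theorem
  (obtained here from Shanks's finite identity) writes it as an alternating theta series at the
  parameter \<open>2 l / 3\<close>. Its leading terms add up to \<open>2 cos (\<pi> / 6) = \<surd>3\<close>, the next pair has the factor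
  \<open>cos (\<pi> / 2) = 0\<close>, and so the relative error is \<open>O(exp (- 4 \<pi> l))\<close>
  (\<open>euler_function_approx\<close>), which is negligible in both formulas.

  Poisson summation itself rests on the fact that a continuous periodic function whose Fourier
  coefficients all vanish is zero, derived from the Stone-Weierstrass theorem on the circle, and on
  the characteristic function of the normal distribution.
\<close>

section \<open>Uniqueness of Fourier coefficients\<close>

text \<open>
  Functions are considered on one period only; periodicity enters when they are transported to the
  unit circle.
\<close>

definition zero_fourier :: "(real \<Rightarrow> complex) set" where
  "zero_fourier = {g. continuous_on {0..1} g \<and>
     (\<forall>j::int. integral {0..1} (\<lambda>t. g t * cis (2 * pi * of_int j * t)) = 0)}"

lemma zero_fourier_add:
  assumes "f \<in> zero_fourier" "g \<in> zero_fourier"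
  shows "(\<lambda>t. f t + g t) \<in> zero_fourier"
proof -
  have "(\<lambda>t. f t * cis (2 * pi * of_int j * t)) integrable_on {0..1}"
       "(\<lambda>t. g t * cis (2 * pi * of_int j * t)) integrable_on {0..1}" for j :: int
    using assms by (auto simp: zero_fourier_def intro!: integrable_continuous_interval continuous_intros)
  with assms show ?thesis
    by (auto simp: zero_fourier_def algebra_simps integral_add intro!: continuous_intros)
qed

lemma zero_fourier_cmult:
  assumes "f \<in> zero_fourier"
  shows "(\<lambda>t. c * f t) \<in> zero_fourier"
  using assms by (auto simp: zero_fourier_def mult.assoc intro!: continuous_intros)

text \<open>
  Multiplication by a character only shifts the Fourier coefficients. Together with linearity this
  makes the set stable under multiplication by every trigonometric polynomial.
\<close>

lemma zero_fourier_shift: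
  assumes "f \<in> zero_fourier"
  shows "(\<lambda>t. cis (2 * pi * of_int k * t) * f t) \<in> zero_fourier"
proof -
  have eq: "cis (2 * pi * of_int k * t) * f t * cis (2 * pi * of_int j * t) =
        f t * cis (2 * pi * of_int (k + j) * t)" for j t
    by (simp add: cis_mult algebra_simps)
  have "integral {0..1} (\<lambda>t. f t * cis (2 * pi * of_int (k + j) * t)) = 0" for j
    using assms unfolding zero_fourier_def by blast
  thus ?thesis using assms
    unfolding zero_fourier_def by (auto simp: eq simp del: of_int_add intro!: continuous_intros)
qed

text \<open>
  The functions on the circle that multiply \<open>zero_fourier\<close> into itself form an algebra containing
  \<open>Re\<close> and \<open>Im\<close>, hence separating points. By Stone-Weierstrass every continuous function
  on the circle is a uniform limit of such multipliers, and each of them is orthogonal to \<open>h\<close>.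
  Working with multipliers avoids any bookkeeping with coefficients of trigonometric polynomials.
\<close>

lemma zero_fourier_orthogonal:
  assumes h: "h \<in> zero_fourier" and f: "continuous_on (sphere 0 1) f"
  shows "integral {0..1} (\<lambda>t. complex_of_real (f (cis (2 * pi * t))) * h t) = 0"
proof -
  define e where "e = (\<lambda>t. cis (2 * pi * t))"
  define P where "P = (\<lambda>f. continuous_on (sphere 0 1) f \<and>
      (\<forall>g\<in>zero_fourier. (\<lambda>t. complex_of_real (f (e t)) * g t) \<in> zero_fourier))"
  have e_sphere: "e t \<in> sphere 0 1" for t by (simp add: e_def)
  have e_cont: "continuous_on A e" for A unfolding e_def by (intro continuous_intros)
  have cont_comp: "continuous_on A (\<lambda>t. complex_of_real (f (e t)))"
    if "continuous_on (sphere 0 1) f" for A f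
    by (intro continuous_intros continuous_on_compose2[OF that e_cont]) (use e_sphere in auto)
  have hc: "continuous_on {0..1} h" using h by (simp add: zero_fourier_def)
  obtain B where B: "\<And>t. t \<in> {0..1} \<Longrightarrow> norm (h t) \<le> B" "B > 0"
  proof -
    have "bounded (h ` {0..1})"
      by (intro compact_imp_bounded compact_continuous_image hc) auto
    then obtain b where "b > 0" "\<forall>x\<in>h ` {0..1}. norm x \<le> b"
      unfolding bounded_pos by blast
    thus ?thesis by (intro that[of b]) auto
  qed
  have P_add: "P (\<lambda>x. f x + g x)" if "P f \<and> P g" for f g
    using that unfolding P_def
    by (auto simp: algebra_simps intro!: continuous_intros zero_fourier_add)
  have P_mult: "P (\<lambda>x. f x * g x)" if "P f \<and> P g" for f g
    using that unfolding P_def by (auto simp: mult.assoc intro!: continuous_intros)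
  have P_const: "P (\<lambda>_. c)" for c
    unfolding P_def by (auto intro: zero_fourier_cmult)
  have P_Re: "P Re"
  proof -
    have eq: "complex_of_real (Re (e t)) * g t =
       (1/2) * (cis (2 * pi * of_int 1 * t) * g t + cis (2 * pi * of_int (-1) * t) * g t)" for g t
      by (simp add: e_def complex_eq_iff)
    have "(\<lambda>t. complex_of_real (Re (e t)) * g t) \<in> zero_fourier" if "g \<in> zero_fourier" for g
      unfolding eq by (intro zero_fourier_cmult zero_fourier_add zero_fourier_shift that)
    thus ?thesis by (auto simp: P_def intro!: continuous_intros)
  qed
  have P_Im: "P Im"
  proof -
    have eq: "complex_of_real (Im (e t)) * g t =
       (-\<i>/2) * (cis (2 * pi * of_int 1 * t) * g t + (-1) * (cis (2 * pi * of_int (-1) * t) * g t))" for g t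
      by (simp add: e_def complex_eq_iff)
    have "(\<lambda>t. complex_of_real (Im (e t)) * g t) \<in> zero_fourier" if "g \<in> zero_fourier" for g
      unfolding eq by (intro zero_fourier_cmult zero_fourier_add zero_fourier_shift that)
    thus ?thesis by (auto simp: P_def intro!: continuous_intros)
  qed
  have approx: "\<exists>g. P g \<and> (\<forall>x\<in>sphere 0 1. \<bar>f x - g x\<bar> < \<epsilon>)" if "\<epsilon> > 0" for \<epsilon>
  proof (rule Stone_Weierstrass_HOL)
    show "\<exists>f. P f \<and> f x \<noteq> f y" if "x \<in> sphere 0 1 \<and> y \<in> sphere 0 1 \<and> x \<noteq> y" for x y :: complex
      using that P_Re P_Im by (metis complex_eqI)
  qed (use that f P_const P_add P_mult in \<open>auto simp: P_def\<close>)
  define I where "I = integral {0..1} (\<lambda>t. complex_of_real (f (e t)) * h t)"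
  \<comment> \<open>The coefficient with index 0 of \<open>g \<cdot> h\<close> vanishes, so only the
    approximation error contributes to the integral.\<close>
  have "norm I \<le> \<epsilon>" if "\<epsilon> > 0" for \<epsilon>
  proof -
    obtain g where g: "P g" and fg: "\<And>x. x \<in> sphere 0 1 \<Longrightarrow> \<bar>f x - g x\<bar> < \<epsilon> / B"
      using approx[of "\<epsilon> / B"] \<open>\<epsilon> > 0\<close> B by auto
    have gc: "continuous_on (sphere 0 1) g" using g by (simp add: P_def)
    have gz: "integral {0..1} (\<lambda>t. complex_of_real (g (e t)) * h t) = 0"
    proof -
      have "(\<lambda>t. complex_of_real (g (e t)) * h t) \<in> zero_fourier"
        using g h by (auto simp: P_def)
      hence "integral {0..1} (\<lambda>t. complex_of_real (g (e t)) * h t * cis (2 * pi * of_int 0 * t)) = 0"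
        unfolding zero_fourier_def by blast
      thus ?thesis by simp
    qed
    have "I = integral {0..1} (\<lambda>t. complex_of_real (f (e t)) * h t - complex_of_real (g (e t)) * h t)"
      unfolding I_def
      by (subst integral_diff)
         (auto simp: gz intro!: integrable_continuous_interval continuous_intros cont_comp f gc hc)
    also have "norm \<dots> \<le> \<epsilon> * (1 - 0)"
    proof (rule integral_bound)
      fix t :: real assume t: "t \<in> {0..1}"
      have "norm (complex_of_real (f (e t)) * h t - complex_of_real (g (e t)) * h t) =
            \<bar>f (e t) - g (e t)\<bar> * norm (h t)"
        by (metis left_diff_distrib norm_mult norm_of_real of_real_diff)
      also have "\<dots> \<le> (\<epsilon> / B) * B"
        using fg[OF e_sphere, of t] B(1)[OF t] B(2) \<open>\<epsilon> > 0\<close> by (intro mult_mono) auto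
      finally show "norm (complex_of_real (f (e t)) * h t - complex_of_real (g (e t)) * h t) \<le> \<epsilon>"
        using B by simp
    qed (auto intro!: continuous_intros cont_comp f gc hc)
    finally show ?thesis by simp
  qed
  hence "norm I \<le> 0" by (metis field_le_epsilon add_0)
  thus ?thesis by (simp add: I_def e_def)
qed

lemma integer_period:
  assumes "\<And>t::real. h (t + 1) = h t"
  shows "h (t + of_int k) = h t"
proof (induction k rule: int_induct[where k = 0])
  case (step1 i)
  thus ?case using assms[of "t + of_int i"] by (simp add: add.assoc)
next
  case (step2 i)
  thus ?case using assms[of "t + of_int (i - 1)"] by (simp add: add.assoc)
qed auto

text \<open>
  A logarithm gives the factor function. Its branch cut is harmless: near the cut the logarithm of the
  antipodal point can be used, because by periodicity the choice of branch does not affect the value.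
\<close>

lemma periodic_factors_through_circle:
  fixes h :: "real \<Rightarrow> complex"
  assumes cont: "continuous_on UNIV h" and per: "\<And>t. h (t + 1) = h t"
  obtains H where "continuous_on (sphere 0 1) H" "\<And>t. H (cis (2 * pi * t)) = h t"
proof -
  have per': "h s = h t" if "cis (2 * pi * s) = cis (2 * pi * t)" for s t
  proof -
    have "exp (\<i> * of_real (2 * pi * s)) = exp (\<i> * of_real (2 * pi * t))"
      using that by (simp add: cis_conv_exp)
    then obtain k :: int where "\<i> * of_real (2 * pi * s) = \<i> * of_real (2 * pi * t) + of_int (2 * k) * pi * \<i>"
      by (auto simp: exp_eq)
    hence "Im (\<i> * of_real (2 * pi * s)) = Im (\<i> * of_real (2 * pi * t) + of_int (2 * k) * pi * \<i>)"
      by (rule arg_cong)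
    hence "(2 * pi) * s = (2 * pi) * (t + of_int k)" by (simp add: algebra_simps)
    hence "s = t + of_int k" by (simp only: mult_cancel_left) auto
    thus ?thesis using integer_period[of h, OF per] by simp
  qed
  define H where "H = (\<lambda>u. h (Im (Ln u) / (2 * pi)))"
  have cis_Ln: "cis (Im (Ln u)) = u" if "norm u = 1" for u
  proof -
    have "u \<noteq> 0" using that by auto
    have "exp (Ln u) = of_real (exp (Re (Ln u))) * cis (Im (Ln u))"
      by (rule exp_eq_polar)
    thus ?thesis using that \<open>u \<noteq> 0\<close> by simp
  qed
  have H: "H (cis (2 * pi * t)) = h t" for t
    unfolding H_def by (rule per') (simp add: cis_Ln)
  have hcont: "isCont h x" for x using cont by (simp add: continuous_on_eq_continuous_at)
  have "continuous (at u within sphere 0 1) H" if u: "u \<in> sphere 0 1" for u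
  proof (cases "u \<in> \<real>\<^sub>\<le>\<^sub>0")
    case False
    have "isCont (\<lambda>u. Im (Ln u) / (2 * pi)) u"
      using False by (intro continuous_intros) auto
    hence "isCont H u" unfolding H_def by (rule isCont_o2[OF _ hcont])
    thus ?thesis by (rule continuous_at_imp_continuous_within)
  next
    case True
    have "- u \<notin> \<real>\<^sub>\<le>\<^sub>0" using True u by (auto elim!: nonpos_Reals_cases)
    hence "isCont (\<lambda>u. Im (Ln (-u)) / (2 * pi) + 1 / 2) u"
      by (intro continuous_intros) auto
    hence "isCont (\<lambda>u. h (Im (Ln (-u)) / (2 * pi) + 1 / 2)) u"
      by (rule isCont_o2[OF _ hcont])
    hence *: "continuous (at u within sphere 0 1) (\<lambda>u. h (Im (Ln (-u)) / (2 * pi) + 1 / 2))"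
      by (rule continuous_at_imp_continuous_within)
    have eq: "h (Im (Ln (-w)) / (2 * pi) + 1 / 2) = H w" if "w \<in> sphere 0 1" for w
    proof -
      have "2 * pi * (Im (Ln (-w)) / (2 * pi) + 1 / 2) = Im (Ln (-w)) + pi"
        by (simp add: field_simps)
      hence "cis (2 * pi * (Im (Ln (-w)) / (2 * pi) + 1 / 2)) = cis (Im (Ln (-w))) * cis pi"
        by (simp only: cis_mult)
      also have "\<dots> = w" using that by (subst cis_Ln) auto
      finally have "H w = H (cis (2 * pi * (Im (Ln (-w)) / (2 * pi) + 1 / 2)))" by simp
      thus ?thesis by (simp only: H)
    qed
    show ?thesis
      by (rule continuous_transform_within[OF * zero_less_one u]) (use eq in auto)
  qed
  hence "continuous_on (sphere 0 1) H" by (simp add: continuous_on_eq_continuous_within)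
  thus ?thesis using H that by blast
qed

text \<open>
  Orthogonality to the continuous functions \<open>Re \<circ> H\<close> and \<open>Im \<circ> H\<close> makes the integrals of
  \<open>(Re h)\<^sup>2\<close> and \<open>(Im h)\<^sup>2\<close> vanish.
\<close>

lemma zero_fourier_imp_zero:
  fixes h :: "real \<Rightarrow> complex"
  assumes cont: "continuous_on UNIV h" and per: "\<And>t. h (t + 1) = h t"
    and coeff: "\<And>j::int. integral {0..1} (\<lambda>t. h t * cis (2 * pi * of_int j * t)) = 0"
    and t: "t \<in> {0..1}"
  shows "h t = 0"
proof -
  obtain H where H: "continuous_on (sphere 0 1) H" "\<And>t. H (cis (2 * pi * t)) = h t"
    using periodic_factors_through_circle[OF cont per] by metis
  have hc: "continuous_on A h" for A using cont continuous_on_subset by blast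
  have hz: "h \<in> zero_fourier" using coeff hc by (simp add: zero_fourier_def)
  have int: "(\<lambda>t. of_real (Re (h t)) * h t) integrable_on {0..1}"
            "(\<lambda>t. of_real (Im (h t)) * h t) integrable_on {0..1}"
    by (intro integrable_continuous_interval continuous_intros hc)+
  have "integral {0..1} (\<lambda>t. of_real (Re (h t)) * h t) = 0"
    using zero_fourier_orthogonal[OF hz continuous_on_Re[OF H(1)]] by (simp add: H(2))
  with int(1) have "((\<lambda>t. of_real (Re (h t)) * h t) has_integral 0) {0..1}"
    by (metis integrable_integral)
  from has_integral_linear[OF this bounded_linear_Re]
  have R: "((\<lambda>t. (Re (h t))\<^sup>2) has_integral 0) {0..1}" by (simp add: o_def power2_eq_square)
  have "integral {0..1} (\<lambda>t. of_real (Im (h t)) * h t) = 0"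
    using zero_fourier_orthogonal[OF hz continuous_on_Im[OF H(1)]] by (simp add: H(2))
  with int(2) have "((\<lambda>t. of_real (Im (h t)) * h t) has_integral 0) {0..1}"
    by (metis integrable_integral)
  from has_integral_linear[OF this bounded_linear_Im]
  have I: "((\<lambda>t. (Im (h t))\<^sup>2) has_integral 0) {0..1}" by (simp add: o_def power2_eq_square)
  have "(Re (h t))\<^sup>2 = 0"
  proof (rule has_integral_0_cbox_imp_0[of 0 1 "\<lambda>t. (Re (h t))\<^sup>2" t])
    show "continuous_on (cbox 0 1) (\<lambda>t. (Re (h t))\<^sup>2)" by (intro continuous_intros hc)
  qed (use R t in auto)
  moreover have "(Im (h t))\<^sup>2 = 0"
  proof (rule has_integral_0_cbox_imp_0[of 0 1 "\<lambda>t. (Im (h t))\<^sup>2" t])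
    show "continuous_on (cbox 0 1) (\<lambda>t. (Im (h t))\<^sup>2)" by (intro continuous_intros hc)
  qed (use I t in auto)
  ultimately show ?thesis by (simp add: complex_eq_iff)
qed

section \<open>Poisson summation\<close>

lemma integral_cis_unit_interval:
  "integral {0..1} (\<lambda>t. cis (2 * pi * of_int k * t)) = (if k = 0 then 1 else 0)"
proof (cases "k = 0")
  case False
  define c where "c = complex_of_real (2 * pi * of_int k) * \<i>"
  have c: "c \<noteq> 0" using False by (simp add: c_def)
  have cis: "cis (2 * pi * of_int k * t) = exp (c * of_real t)" for t
    by (simp add: c_def cis_conv_exp mult_ac)
  have "((\<lambda>t. exp (c * of_real t)) has_integral (exp (c * of_real 1) / c - exp (c * of_real 0) / c)) {0..1}"
  proof (rule fundamental_theorem_of_calculus)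
    fix t :: real
    have "((\<lambda>z. exp (c * z) / c) has_field_derivative exp (c * of_real t)) (at (of_real t))"
      using c by (auto intro!: derivative_eq_intros)
    from has_vector_derivative_real_field[OF this]
    show "((\<lambda>t. exp (c * of_real t) / c) has_vector_derivative exp (c * of_real t)) (at t within {0..1})" .
  qed auto
  moreover have "exp (c * of_real 1) = 1"
    using cis[of 1, symmetric] cis_multiple_2pi[of "of_int k"] by (simp add: mult_ac)
  ultimately show ?thesis using False by (auto simp: cis intro!: integral_unique)
qed simp

text \<open>
  Turns an unconditional sum over the integers into a limit along any exhausting sequence of finite
  sets.
\<close>

lemma filterlim_finite_int_sets:
  fixes F :: "nat \<Rightarrow> int set"
  assumes "\<And>n. finite (F n)"
    and "\<And>N. \<forall>\<^sub>F n in sequentially. {- int N..int N} \<subseteq> F n"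
  shows "filterlim F (finite_subsets_at_top UNIV) sequentially"
  unfolding filterlim_finite_subsets_at_top
proof safe
  fix X :: "int set" assume "finite X"
  define N where "N = nat (Max (insert 0 (abs ` X)))"
  have "\<bar>x\<bar> \<le> Max (insert 0 (abs ` X))" if "x \<in> X" for x
    using that \<open>finite X\<close> by (intro Max_ge) auto
  hence X: "X \<subseteq> {- int N..int N}" unfolding N_def by fastforce
  show "\<forall>\<^sub>F n in sequentially. finite (F n) \<and> X \<subseteq> F n \<and> F n \<subseteq> UNIV"
    using assms(2)[of N] by eventually_elim (use X assms(1) in blast)
qed

lemma integral_symmetric_limit:
  fixes \<psi> :: "real \<Rightarrow> complex"
  assumes cont: "continuous_on UNIV \<psi>" and int: "has_bochner_integral lborel \<psi> a"
  shows "(\<lambda>n. integral {-real n..real n} \<psi>) \<longlonglongrightarrow> a"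
proof -
  have eq: "integral {-real n..real n} \<psi> = (LINT x|lborel. indicator {-real n..real n} x *\<^sub>R \<psi> x)" for n
  proof -
    have "set_integrable lborel {-real n..real n} \<psi>"
      using cont by (intro borel_integrable_atLeastAtMost') (auto intro: continuous_on_subset)
    from set_borel_integral_eq_integral(2)[OF this] show ?thesis
      by (simp add: set_lebesgue_integral_def)
  qed
  have i: "integrable lborel \<psi>" and a: "a = (LINT x|lborel. \<psi> x)"
    using int by (auto simp: has_bochner_integral_iff)
  show ?thesis unfolding eq a
  proof (rule integral_dominated_convergence[where w = "\<lambda>x. norm (\<psi> x)"])
    show "AE x in lborel. (\<lambda>n. indicator {-real n..real n} x *\<^sub>R \<psi> x) \<longlonglongrightarrow> \<psi> x"
    proof (intro AE_I2 tendsto_eventually)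
      fix x :: real
      show "\<forall>\<^sub>F n in sequentially. indicator {-real n..real n} x *\<^sub>R \<psi> x = \<psi> x"
        using eventually_ge_at_top[of "nat \<lceil>\<bar>x\<bar>\<rceil>"]
      proof eventually_elim
        case (elim n)
        hence "\<bar>x\<bar> \<le> real n" by linarith
        thus ?case by (auto simp: indicator_def)
      qed
    qed
  qed (use i in \<open>auto simp: indicator_def\<close>)
qed

text \<open>
  Unfolding: the integrals of the translates over the unit interval are the integrals over consecutive
  unit intervals, so they add up to the integral over the whole line.
\<close>

lemma integral_periodization:
  fixes \<psi> :: "real \<Rightarrow> complex"
  assumes cont: "continuous_on UNIV \<psi>" and int: "has_bochner_integral lborel \<psi> a"
    and M: "M summable_on UNIV" "\<And>m t. t \<in> {0..1} \<Longrightarrow> norm (\<psi> (t + of_int m)) \<le> M m"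
  shows "integral {0..1} (\<lambda>t. \<Sum>\<^sub>\<infinity>m. \<psi> (t + of_int m)) = a"
proof -
  have c: "continuous_on A (\<lambda>t. \<psi> (t + of_int m))" for A and m :: int
    by (intro continuous_on_compose2[OF cont] continuous_intros) auto
  have "uniform_limit {0..1} (\<lambda>X t. \<Sum>m\<in>X. \<psi> (t + of_int m))
          (\<lambda>t. \<Sum>\<^sub>\<infinity>m. \<psi> (t + of_int m)) (finite_subsets_at_top UNIV)"
    using M by (intro Weierstrass_m_test_general[where M = M]) auto
  then obtain I J where I: "\<And>X. ((\<lambda>t. \<Sum>m\<in>X. \<psi> (t + of_int m)) has_integral I X) {0..1}"
    and J: "((\<lambda>t. \<Sum>\<^sub>\<infinity>m. \<psi> (t + of_int m)) has_integral J) {0..1}"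
    and lim: "(I \<longlongrightarrow> J) (finite_subsets_at_top UNIV)"
    by (rule uniform_limit_integral) (auto intro!: continuous_intros c)
  have "(\<lambda>n. I {- int n..<int n}) \<longlonglongrightarrow> J"
  proof (rule filterlim_compose[OF lim], rule filterlim_finite_int_sets)
    show "\<forall>\<^sub>F n in sequentially. {- int N..int N} \<subseteq> {- int n..<int n}" for N
      using eventually_gt_at_top[of N] by eventually_elim auto
  qed auto
  moreover have "I {- int n..<int n} = integral {-real n..real n} \<psi>" for n
  proof -
    have shift: "integral {0..1} (\<lambda>t. \<psi> (t + of_int m)) = integral {of_int m..of_int (m + 1)} \<psi>" for m
      using integral_shift_Icc_real[of 0 1 \<psi> "of_int m"] by (simp add: o_def add_ac)
    have sum_eq: "(\<Sum>m\<in>{i..<i + int k}. integral {of_int m..of_int (m + 1)} \<psi>)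
                 = integral {of_int i..of_int i + real k} \<psi>" for i k
    proof (induction k)
      case (Suc k)
      have "{i..<i + int (Suc k)} = insert (i + int k) {i..<i + int k}" by auto
      hence "(\<Sum>m\<in>{i..<i + int (Suc k)}. integral {of_int m..of_int (m + 1)} \<psi>)
             = integral {of_int i..of_int i + real k} \<psi> + integral {of_int i + real k..of_int i + real (Suc k)} \<psi>"
        using Suc by (simp add: algebra_simps)
      also have "\<dots> = integral {of_int i..of_int i + real (Suc k)} \<psi>"
        by (rule Henstock_Kurzweil_Integration.integral_combine)
           (auto intro!: integrable_continuous_interval continuous_on_subset[OF cont])
      finally show ?case .
    qed simp
    have "I {- int n..<int n} = integral {0..1} (\<lambda>t. \<Sum>m\<in>{- int n..<int n}. \<psi> (t + of_int m))"
      by (rule integral_unique[OF I, symmetric])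
    also have "\<dots> = (\<Sum>m\<in>{- int n..<int n}. integral {0..1} (\<lambda>t. \<psi> (t + of_int m)))"
      by (rule integral_sum) (auto intro!: integrable_continuous_interval c)
    also have "\<dots> = integral {-real n..real n} \<psi>"
      using sum_eq[of "- int n" "2 * n"] by (simp add: shift)
    finally show ?thesis .
  qed
  ultimately have "(\<lambda>n. integral {-real n..real n} \<psi>) \<longlonglongrightarrow> J" by simp
  hence "J = a" using integral_symmetric_limit[OF cont int] LIMSEQ_unique by blast
  thus ?thesis using J by (simp add: integral_unique)
qed

lemma integral_fourier_series:
  fixes a :: "int \<Rightarrow> complex"
  assumes a: "(\<lambda>k. norm (a k)) summable_on UNIV"
  shows "integral {0..1} (\<lambda>t. (\<Sum>\<^sub>\<infinity>k. a k * cis (- 2 * pi * of_int k * t)) * cis (2 * pi * of_int j * t)) = a j"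
proof -
  have eq: "(\<Sum>\<^sub>\<infinity>k. a k * cis (- 2 * pi * of_int k * t)) * cis (2 * pi * of_int j * t) =
            (\<Sum>\<^sub>\<infinity>k. a k * cis (2 * pi * of_int (j - k) * t))" for t
    by (subst infsum_cmult_left'[symmetric], intro infsum_cong, simp only: mult.assoc cis_mult)
       (simp add: algebra_simps)
  have "uniform_limit {0..1} (\<lambda>X t. \<Sum>k\<in>X. a k * cis (2 * pi * of_int (j - k) * t))
          (\<lambda>t. \<Sum>\<^sub>\<infinity>k. a k * cis (2 * pi * of_int (j - k) * t)) (finite_subsets_at_top UNIV)"
    using a by (intro Weierstrass_m_test_general[where M = "\<lambda>k. norm (a k)"]) (auto simp: norm_mult)
  then obtain I J where I: "\<And>X. ((\<lambda>t. \<Sum>k\<in>X. a k * cis (2 * pi * of_int (j - k) * t)) has_integral I X) {0..1}"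
    and J: "((\<lambda>t. \<Sum>\<^sub>\<infinity>k. a k * cis (2 * pi * of_int (j - k) * t)) has_integral J) {0..1}"
    and lim: "(I \<longlongrightarrow> J) (finite_subsets_at_top UNIV)"
    by (rule uniform_limit_integral) (auto intro!: continuous_intros)
  have IX: "I X = a j" if X: "finite X" "j \<in> X" for X
  proof -
    have "I X = integral {0..1} (\<lambda>t. \<Sum>k\<in>X. a k * cis (2 * pi * of_int (j - k) * t))"
      by (rule integral_unique[OF I, symmetric])
    also have "\<dots> = (\<Sum>k\<in>X. integral {0..1} (\<lambda>t. a k * cis (2 * pi * of_int (j - k) * t)))"
      using X by (intro integral_sum) (auto intro!: integrable_continuous_interval continuous_intros)
    also have "\<dots> = (\<Sum>k\<in>X. if k = j then a k else 0)"
      by (intro sum.cong refl) (simp add: integral_cis_unit_interval del: of_int_diff)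
    finally show ?thesis using X by simp
  qed
  have "\<forall>\<^sub>F X in finite_subsets_at_top UNIV. I X = a j"
    by (rule eventually_finite_subsets_at_top[THEN iffD2, OF exI[of _ "{j}"]]) (auto intro!: IX)
  hence "(I \<longlongrightarrow> a j) (finite_subsets_at_top UNIV)"
    by (rule tendsto_eventually)
  hence "J = a j" using lim tendsto_unique finite_subsets_at_top_neq_bot by blast
  thus ?thesis unfolding eq using J by (simp only: integral_unique)
qed

text \<open>
  Both sides are continuous functions of period \<open>1\<close> with the same Fourier coefficients \<open>a\<close>: the left
  one by unfolding, the right one by uniform convergence. The domination hypothesis is required on every
  bounded set, and not only on a period, so that continuity of the left side holds across the
  endpoints of the period.
\<close>

theorem poisson_summation:
  fixes \<phi> :: "real \<Rightarrow> complex" and a :: "int \<Rightarrow> complex"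
  assumes cont: "continuous_on UNIV \<phi>"
    and dom: "\<And>R. \<exists>M. M summable_on UNIV \<and> (\<forall>m t. \<bar>t\<bar> \<le> R \<longrightarrow> norm (\<phi> (t + of_int m)) \<le> M m)"
    and fourier: "\<And>j. has_bochner_integral lborel (\<lambda>x. \<phi> x * cis (2 * pi * of_int j * x)) (a j)"
    and a: "(\<lambda>k. norm (a k)) summable_on UNIV"
    and t: "t \<in> {0..1}"
  shows "(\<Sum>\<^sub>\<infinity>m. \<phi> (t + of_int m)) = (\<Sum>\<^sub>\<infinity>k. a k * cis (- 2 * pi * of_int k * t))"
proof -
  define P where "P = (\<lambda>t. \<Sum>\<^sub>\<infinity>m. \<phi> (t + of_int m))"
  define F where "F = (\<lambda>t. \<Sum>\<^sub>\<infinity>k. a k * cis (- 2 * pi * of_int k * t))"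
  have F_cont: "continuous_on A F" for A
  proof -
    have "uniform_limit A (\<lambda>X t. \<Sum>k\<in>X. a k * cis (- 2 * pi * of_int k * t)) F (finite_subsets_at_top UNIV)"
      unfolding F_def using a
      by (intro Weierstrass_m_test_general[where M = "\<lambda>k. norm (a k)"]) (auto simp: norm_mult)
    thus ?thesis
      by (rule uniform_limit_theorem[rotated]) (auto intro!: always_eventually continuous_intros)
  qed
  have P_cont': "continuous_on {-R..R} P" for R
  proof -
    obtain M where "M summable_on UNIV" "\<And>m t. \<bar>t\<bar> \<le> R \<Longrightarrow> norm (\<phi> (t + of_int m)) \<le> M m"
      using dom by blast
    hence "uniform_limit {-R..R} (\<lambda>X t. \<Sum>m\<in>X. \<phi> (t + of_int m)) P (finite_subsets_at_top UNIV)"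
      unfolding P_def by (intro Weierstrass_m_test_general[where M = M]) auto
    thus ?thesis
      by (rule uniform_limit_theorem[rotated])
         (auto intro!: always_eventually continuous_intros continuous_on_compose2[OF cont])
  qed
  have "isCont P x" for x
  proof (rule continuous_on_interior[OF P_cont'])
    show "x \<in> interior {-(\<bar>x\<bar> + 1)..\<bar>x\<bar> + 1}" by (simp add: interior_atLeastAtMost_real) linarith
  qed
  hence P_cont: "continuous_on A P" for A by (simp add: continuous_at_imp_continuous_on)
  have P_per: "P (t + 1) = P t" for t
    unfolding P_def
    by (rule infsum_reindex_bij_witness[where i = "\<lambda>m. m - 1" and j = "\<lambda>m. m + 1"]) (auto simp: add_ac)
  have F_per: "F (t + 1) = F t" for t
  proof -
    have "cis (- 2 * pi * of_int k * (t + 1)) = cis (- 2 * pi * of_int k * t)" for k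
    proof -
      have "cis (- 2 * pi * of_int k * (t + 1)) = cis (- 2 * pi * of_int k * t) * cis (2 * pi * of_int (-k))"
        by (simp only: cis_mult) (simp add: algebra_simps)
      also have "cis (2 * pi * of_int (-k)) = 1"
        by (rule cis_multiple_2pi) simp
      finally show ?thesis by simp
    qed
    thus ?thesis unfolding F_def by (simp only:)
  qed
  have coeff: "integral {0..1} (\<lambda>t. (P t - F t) * cis (2 * pi * of_int j * t)) = 0" for j
  proof -
    define \<psi> where "\<psi> = (\<lambda>x. \<phi> x * cis (2 * pi * of_int j * x))"
    have \<psi>: "\<psi> (t + of_int m) = \<phi> (t + of_int m) * cis (2 * pi * of_int j * t)" for t and m :: int
    proof -
      have "cis (2 * pi * of_int j * (t + of_int m)) = cis (2 * pi * of_int j * t) * cis (2 * pi * of_int (j * m))"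
        by (simp only: cis_mult) (simp add: algebra_simps)
      also have "cis (2 * pi * of_int (j * m)) = 1"
        by (rule cis_multiple_2pi) simp
      finally show ?thesis by (simp add: \<psi>_def)
    qed
    obtain M where "M summable_on UNIV" "\<And>m t. \<bar>t\<bar> \<le> 1 \<Longrightarrow> norm (\<phi> (t + of_int m)) \<le> M m"
      using dom by blast
    hence "integral {0..1} (\<lambda>t. \<Sum>\<^sub>\<infinity>m. \<psi> (t + of_int m)) = a j"
      using fourier[of j] cont
      by (intro integral_periodization[where M = M])
         (auto simp: \<psi> norm_mult, auto simp: \<psi>_def intro!: continuous_intros)
    hence "integral {0..1} (\<lambda>t. P t * cis (2 * pi * of_int j * t)) = a j"
      by (simp add: \<psi> P_def infsum_cmult_left')
    moreover have "integral {0..1} (\<lambda>t. F t * cis (2 * pi * of_int j * t)) = a j"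
      unfolding F_def by (rule integral_fourier_series[OF a])
    ultimately show ?thesis
      by (simp only: left_diff_distrib, subst integral_diff)
         (auto intro!: integrable_continuous_interval continuous_intros P_cont F_cont)
  qed
  have "P t - F t = 0"
    by (rule zero_fourier_imp_zero[of "\<lambda>t. P t - F t"])
       (use coeff t in \<open>auto intro!: continuous_intros P_cont F_cont simp: P_per F_per\<close>)
  thus ?thesis by (simp add: P_def F_def)
qed

text \<open>
  The characteristic function of the standard normal distribution, after rescaling the variable by
  \<open>c = \<surd>(2 \<pi> l)\<close>.
\<close>

lemma gaussian_fourier_transform:
  assumes "l > 0"
  shows "has_bochner_integral lborel (\<lambda>x. complex_of_real (exp (- pi * l * x\<^sup>2)) * cis (2 * pi * s * x))
           (of_real (exp (- pi * s\<^sup>2 / l) / sqrt l))"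
proof -
  interpret N: real_distribution std_normal_distribution by (rule real_dist_normal_dist)
  define c where "c = sqrt (2 * pi * l)"
  define t where "t = 2 * pi * s / c"
  have c: "c > 0" using assms by (simp add: c_def)
  have c2: "c\<^sup>2 = 2 * pi * l" using assms by (simp add: c_def)
  have t2: "t\<^sup>2 / 2 = pi * s\<^sup>2 / l"
    using assms by (simp add: t_def power_divide c2) (simp add: field_simps power2_eq_square)
  have "integrable std_normal_distribution (\<lambda>x. iexp (t * x))"
    by (rule N.integrable_iexp) auto
  hence "integrable lborel (\<lambda>x. std_normal_density x *\<^sub>R iexp (t * x))"
    by (subst (asm) integrable_density) auto
  moreover have "(LINT x|lborel. std_normal_density x *\<^sub>R iexp (t * x)) = of_real (exp (- (t\<^sup>2) / 2))"
    using fun_cong[OF char_std_normal_distribution, of t] unfolding char_def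
    by (subst (asm) integral_density) auto
  ultimately have "has_bochner_integral lborel (\<lambda>x. std_normal_density x *\<^sub>R iexp (t * x)) (of_real (exp (- (t\<^sup>2) / 2)))"
    by (simp add: has_bochner_integral_iff)
  hence "has_bochner_integral lborel (\<lambda>x. std_normal_density (0 + c * x) *\<^sub>R iexp (t * (0 + c * x)))
           (of_real (exp (- (t\<^sup>2) / 2)) /\<^sub>R \<bar>c\<bar>)"
    using c by (subst (asm) lborel_has_bochner_integral_real_affine_iff[of c _ _ 0]) auto
  hence "has_bochner_integral lborel (\<lambda>x. of_real (sqrt (2 * pi)) * (std_normal_density (0 + c * x) *\<^sub>R iexp (t * (0 + c * x))))
           (of_real (sqrt (2 * pi)) * (of_real (exp (- (t\<^sup>2) / 2)) /\<^sub>R \<bar>c\<bar>))"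
    by (intro has_bochner_integral_mult_right) auto
  moreover have "of_real (sqrt (2 * pi)) * (std_normal_density (0 + c * x) *\<^sub>R iexp (t * (0 + c * x))) =
      complex_of_real (exp (- pi * l * x\<^sup>2)) * cis (2 * pi * s * x)" for x
    using c by (simp add: std_normal_density_def power_mult_distrib c2 scaleR_conv_of_real
                  cis_conv_exp t_def mult_ac)
  moreover have "of_real (sqrt (2 * pi)) * (complex_of_real (exp (- (t\<^sup>2) / 2)) /\<^sub>R \<bar>c\<bar>) = of_real (exp (- pi * s\<^sup>2 / l) / sqrt l)"
    using c t2 assms by (simp add: c_def scaleR_conv_of_real real_sqrt_mult field_simps)
  ultimately show ?thesis by simp
qed

section \<open>The theta transformation and its leading terms\<close>

text \<open>
  The tool for the convergence and the error terms of the theta series: a series over the integers is compared with a finite central block,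
  and the two tails are dominated by geometric series.
\<close>

lemma two_sided_geometric_tail:
  fixes a :: "int \<Rightarrow> complex"
  assumes right: "\<And>k::nat. norm (a (hi + 1 + int k)) \<le> B * r ^ k"
    and left: "\<And>k::nat. norm (a (lo - 1 - int k)) \<le> B * r ^ k"
    and r: "0 \<le> r" "r < 1" and le: "lo \<le> hi + 1"
  shows "(\<lambda>m. norm (a m)) summable_on UNIV"
    and "norm ((\<Sum>\<^sub>\<infinity>m. a m) - (\<Sum>m=lo..hi. a m)) \<le> 2 * B / (1 - r)"
proof -
  have geo: "((\<lambda>k. B * r ^ k) has_sum (B / (1 - r))) UNIV"
  proof -
    have "B \<ge> 0" using order_trans[OF norm_ge_zero right[of 0]] by simp
    have "(\<lambda>k. B * r ^ k) sums (B * (1 / (1 - r)))"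
      by (intro sums_mult geometric_sums) (use r in auto)
    thus ?thesis by (intro sums_nonneg_imp_has_sum) (use r \<open>B \<ge> 0\<close> in auto)
  qed
  define R L where "R = {hi + 1..}" and "L = {..lo - 1}"
  have bijR: "bij_betw (\<lambda>k. hi + 1 + int k) UNIV R"
    by (rule bij_betwI[where g = "\<lambda>m. nat (m - (hi + 1))"]) (auto simp: R_def)
  have bijL: "bij_betw (\<lambda>k. lo - 1 - int k) UNIV L"
    by (rule bij_betwI[where g = "\<lambda>m. nat (lo - 1 - m)"]) (auto simp: L_def)
  have sR: "(\<lambda>k. norm (a (hi + 1 + int k))) summable_on UNIV"
    by (rule summable_on_comparison_test[OF has_sum_imp_summable[OF geo]]) (use right in auto)
  have sL: "(\<lambda>k. norm (a (lo - 1 - int k))) summable_on UNIV"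
    by (rule summable_on_comparison_test[OF has_sum_imp_summable[OF geo]]) (use left in auto)
  have SR: "(\<lambda>m. norm (a m)) summable_on R" and SL: "(\<lambda>m. norm (a m)) summable_on L"
    using sR sL summable_on_reindex_bij_betw[OF bijR, of "\<lambda>m. norm (a m)"]
      summable_on_reindex_bij_betw[OF bijL, of "\<lambda>m. norm (a m)"] by auto
  have U: "UNIV = {lo..hi} \<union> (R \<union> L)" using le by (auto simp: R_def L_def)
  show abs: "(\<lambda>m. norm (a m)) summable_on UNIV"
    unfolding U by (intro summable_on_union SR SL summable_on_finite) auto
  have nR: "norm (infsum a R) \<le> B / (1 - r)"
  proof (rule norm_infsum_le[OF _ geo])
    show "((\<lambda>k. a (hi + 1 + int k)) has_sum infsum a R) UNIV"
      using has_sum_infsum[OF abs_summable_summable[OF SR]] has_sum_reindex_bij_betw[OF bijR] by blast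
  qed (use right in auto)
  have nL: "norm (infsum a L) \<le> B / (1 - r)"
  proof (rule norm_infsum_le[OF _ geo])
    show "((\<lambda>k. a (lo - 1 - int k)) has_sum infsum a L) UNIV"
      using has_sum_infsum[OF abs_summable_summable[OF SL]] has_sum_reindex_bij_betw[OF bijL] by blast
  qed (use left in auto)
  have "infsum a UNIV = infsum a {lo..hi} + infsum a (R \<union> L)"
    unfolding U by (rule infsum_Un_disjoint)
      (auto simp: R_def L_def intro!: abs_summable_summable[OF summable_on_subset[OF abs]])
  also have "infsum a (R \<union> L) = infsum a R + infsum a L"
    by (rule infsum_Un_disjoint)
      (use le in \<open>auto simp: R_def L_def intro!: abs_summable_summable[OF summable_on_subset[OF abs]]\<close>)
  finally have "infsum a UNIV - (\<Sum>m=lo..hi. a m) = infsum a R + infsum a L" by simp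
  moreover have "norm (infsum a R + infsum a L) \<le> B / (1 - r) + B / (1 - r)"
    by (intro norm_triangle_mono nR nL)
  ultimately show "norm ((\<Sum>\<^sub>\<infinity>m. a m) - (\<Sum>m=lo..hi. a m)) \<le> 2 * B / (1 - r)" by simp
qed

text \<open>
  The shift is removed by \<open>m\<^sup>2 \<le> 2 y\<^sup>2 + 2 (m - y)\<^sup>2\<close>, and \<open>m\<^sup>2 \<ge> \<bar>m\<bar> - 1\<close> reduces
  to a geometric series.
\<close>

lemma gaussian_summable_on:
  fixes c y :: real
  assumes "c > 0"
  shows "(\<lambda>m::int. exp (- c * (of_int m - y)\<^sup>2)) summable_on UNIV"
proof -
  have "(\<lambda>m::int. norm (complex_of_real (exp (- (c/2) * (of_int m)\<^sup>2)))) summable_on UNIV"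
  proof (rule two_sided_geometric_tail(1)[where hi = 0 and lo = 0 and B = 1 and r = "exp (- (c/2))"])
    have *: "exp (- (c/2) * (real (Suc k))\<^sup>2) \<le> 1 * exp (- (c/2)) ^ k" for k
    proof -
      have "real k \<le> (real (Suc k))\<^sup>2" by (simp add: power2_eq_square algebra_simps)
      thus ?thesis using assms by (simp add: exp_of_nat_mult[symmetric])
    qed
    show "norm (complex_of_real (exp (- (c/2) * (of_int (0 + 1 + int k))\<^sup>2))) \<le> 1 * exp (- (c/2)) ^ k" for k
      using *[of k] by simp
    show "norm (complex_of_real (exp (- (c/2) * (of_int (0 - 1 - int k))\<^sup>2))) \<le> 1 * exp (- (c/2)) ^ k" for k
      using *[of k] by (simp add: power2_commute[of "-1"] power2_eq_square algebra_simps)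
  qed (use assms in auto)
  hence "(\<lambda>m::int. exp (c * y\<^sup>2) * exp (- (c/2) * (of_int m)\<^sup>2)) summable_on UNIV"
    by (intro summable_on_cmult_right) simp
  thus ?thesis
  proof (rule summable_on_comparison_test)
    fix m :: int
    have "(of_int m - 2 * y)\<^sup>2 \<ge> 0" by simp
    hence "(of_int m)\<^sup>2 \<le> 2 * y\<^sup>2 + 2 * (of_int m - y)\<^sup>2"
      by (simp add: power2_eq_square algebra_simps)
    hence "c * (of_int m)\<^sup>2 \<le> c * (2 * y\<^sup>2 + 2 * (of_int m - y)\<^sup>2)"
      using assms by (intro mult_left_mono) auto
    thus "exp (- c * (of_int m - y)\<^sup>2) \<le> exp (c * y\<^sup>2) * exp (- (c/2) * (of_int m)\<^sup>2)"
      by (simp add: exp_add[symmetric] algebra_simps)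
  qed auto
qed
text \<open>
  This is \<open>\<Sum>j. q^(j\<^sup>2) exp (2 \<pi> j (v + \<i> t))\<close> with \<open>q = exp (- \<pi> / l)\<close>. Keeping the real part \<open>v\<close> and
  the imaginary part \<open>t\<close> of the elliptic variable apart allows Poisson summation to act on \<open>t\<close> alone;
  \<open>t = 0\<close> gives the plain series and \<open>t = 1/2\<close> the alternating one.
\<close>

definition theta_sum :: "real \<Rightarrow> real \<Rightarrow> real \<Rightarrow> complex" where
  "theta_sum l v t = (\<Sum>\<^sub>\<infinity>j::int. of_real (exp (- pi * (of_int j)\<^sup>2 / l + 2 * pi * v * of_int j))
      * cis (2 * pi * of_int j * t))"

lemma exp_theta_complete_square:
  assumes "l > 0"
  shows "exp (- pi * (of_int j)\<^sup>2 / l + 2 * pi * v * of_int j) =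
         exp (pi * l * v\<^sup>2) * exp (- (pi / l) * (of_int j - l * v)\<^sup>2)"
  using assms by (simp add: exp_add[symmetric] power2_eq_square field_simps)

lemma theta_term_summable_on:
  assumes "l > 0"
  shows "(\<lambda>j::int. exp (- pi * (of_int j)\<^sup>2 / l + 2 * pi * v * of_int j)) summable_on UNIV"
  unfolding exp_theta_complete_square[OF assms]
  using assms by (intro summable_on_cmult_right gaussian_summable_on) auto

text \<open>
  Poisson summation for the modulated Gaussian \<open>\<phi> x = exp (- \<pi> l x\<^sup>2) cis (2 \<pi> l v x)\<close>. The modulation
  shifts the argument of the Fourier transform to \<open>l v + j\<close>, and expanding the square there produces
  the factor \<open>exp (2 \<pi> v j)\<close>; no complex shift of the Gaussian is needed.
\<close>

theorem theta_transformation: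
  assumes l: "l > 0" and t: "t \<in> {0..1}"
  shows "theta_sum l v t = of_real (sqrt l * exp (pi * l * v\<^sup>2)) *
    (\<Sum>\<^sub>\<infinity>m::int. of_real (exp (- pi * l * (t + of_int m)\<^sup>2)) * cis (2 * pi * (l * v) * (t + of_int m)))"
proof -
  define \<phi> where "\<phi> = (\<lambda>x. complex_of_real (exp (- pi * l * x\<^sup>2)) * cis (2 * pi * (l * v) * x))"
  define a where "a = (\<lambda>j::int. complex_of_real (exp (- pi * (l * v + of_int j)\<^sup>2 / l) / sqrt l))"
  have "(\<Sum>\<^sub>\<infinity>m. \<phi> (t + of_int m)) = (\<Sum>\<^sub>\<infinity>k. a k * cis (- 2 * pi * of_int k * t))"
  proof (rule poisson_summation[OF _ _ _ _ t])
    show "continuous_on UNIV \<phi>" unfolding \<phi>_def by (intro continuous_intros)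
    show "\<exists>M. M summable_on UNIV \<and> (\<forall>m t. \<bar>t\<bar> \<le> R \<longrightarrow> norm (\<phi> (t + of_int m)) \<le> M m)" for R
    proof (intro exI conjI allI impI)
      show "(\<lambda>m::int. exp (pi * l * R\<^sup>2) * exp (- (pi * l / 2) * (of_int m - 0)\<^sup>2)) summable_on UNIV"
        using l by (intro summable_on_cmult_right gaussian_summable_on) auto
      fix m :: int and t :: real assume "\<bar>t\<bar> \<le> R"
      hence "t\<^sup>2 \<le> R\<^sup>2" by (metis abs_ge_zero power2_abs power_mono)
      moreover have "(of_int m + 2 * t)\<^sup>2 \<ge> 0" by simp
      ultimately have "- ((t + of_int m)\<^sup>2) \<le> R\<^sup>2 - (of_int m)\<^sup>2 / 2"
        by (simp add: power2_eq_square algebra_simps)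
      hence "pi * l * (- ((t + of_int m)\<^sup>2)) \<le> pi * l * (R\<^sup>2 - (of_int m)\<^sup>2 / 2)"
        using l by (intro mult_left_mono) auto
      thus "norm (\<phi> (t + of_int m)) \<le> exp (pi * l * R\<^sup>2) * exp (- (pi * l / 2) * (of_int m - 0)\<^sup>2)"
        by (simp add: \<phi>_def norm_mult exp_add[symmetric] algebra_simps)
    qed
    show "has_bochner_integral lborel (\<lambda>x. \<phi> x * cis (2 * pi * of_int j * x)) (a j)" for j
    proof -
      have "\<phi> x * cis (2 * pi * of_int j * x) =
          complex_of_real (exp (- pi * l * x\<^sup>2)) * cis (2 * pi * (l * v + of_int j) * x)" for x
        unfolding \<phi>_def mult.assoc cis_mult by (simp add: algebra_simps)
      thus ?thesis
        using gaussian_fourier_transform[OF l, of "l * v + of_int j"] by (simp add: a_def)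
    qed
    have "norm (a k) = 1 / sqrt l * exp (- (pi / l) * (of_int k - (- (l * v)))\<^sup>2)" for k
      unfolding a_def norm_of_real using l by (simp add: add_ac)
    thus "(\<lambda>k. norm (a k)) summable_on UNIV"
      using l by (simp only:) (intro summable_on_cmult_right gaussian_summable_on; simp)
  qed
  also have "\<dots> = (\<Sum>\<^sub>\<infinity>k. a (- k) * cis (2 * pi * of_int k * t))"
    by (rule infsum_reindex_bij_witness[where i = uminus and j = uminus]) auto
  also have "\<dots> = (\<Sum>\<^sub>\<infinity>j::int. of_real (exp (- (pi * l * v\<^sup>2)) / sqrt l) *
      (of_real (exp (- pi * (of_int j)\<^sup>2 / l + 2 * pi * v * of_int j)) * cis (2 * pi * of_int j * t)))"
  proof (rule infsum_cong)
    fix j :: int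
    have "exp (- pi * (l * v + of_int (- j))\<^sup>2 / l) / sqrt l =
          exp (- (pi * l * v\<^sup>2)) / sqrt l * exp (- pi * (of_int j)\<^sup>2 / l + 2 * pi * v * of_int j)"
      using l by (simp add: exp_add[symmetric] power2_eq_square field_simps)
    thus "a (- j) * cis (2 * pi * of_int j * t) = of_real (exp (- (pi * l * v\<^sup>2)) / sqrt l) *
      (of_real (exp (- pi * (of_int j)\<^sup>2 / l + 2 * pi * v * of_int j)) * cis (2 * pi * of_int j * t))"
      unfolding a_def by (simp only: of_real_mult mult.assoc)
  qed
  also have "\<dots> = of_real (exp (- (pi * l * v\<^sup>2)) / sqrt l) * theta_sum l v t"
    unfolding theta_sum_def by (rule infsum_cmult_right')
  finally have "of_real (sqrt l * exp (pi * l * v\<^sup>2)) * (\<Sum>\<^sub>\<infinity>m. \<phi> (t + of_int m)) =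
      of_real (sqrt l * exp (pi * l * v\<^sup>2) * (exp (- (pi * l * v\<^sup>2)) / sqrt l)) * theta_sum l v t"
    by (simp only: of_real_mult mult.assoc)
  also have "sqrt l * exp (pi * l * v\<^sup>2) * (exp (- (pi * l * v\<^sup>2)) / sqrt l) = 1"
    using l by (simp add: exp_minus)
  finally show ?thesis by (simp add: \<phi>_def)
qed

lemma exp_minus_pi_mult_le:
  assumes "l \<ge> 1"
  shows "exp (- pi * l) \<le> 1 / 2"
proof -
  have "pi * l \<ge> 3 * 1" using assms pi_gt3 by (intro mult_mono) auto
  moreover have "1 + pi * l \<le> exp (pi * l)" by (rule exp_ge_add_one_self)
  ultimately have "exp (pi * l) \<ge> 2" by linarith
  thus ?thesis by (simp add: exp_minus field_simps)
qed

lemma exp_half_geometric_le: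
  assumes "B \<ge> 0" "0 \<le> r" "r \<le> (1/2::real)"
  shows "2 * B / (1 - r) \<le> 4 * B"
proof -
  have "2 * B / (1 - r) \<le> 2 * B / (1/2)" using assms by (intro divide_left_mono) auto
  thus ?thesis by simp
qed

lemma theta_sum_0_approx:
  assumes l: "l \<ge> 1"
  shows "norm (theta_sum l v 0 - of_real (sqrt l * exp (pi * l * v\<^sup>2)))
           \<le> sqrt l * exp (pi * l * v\<^sup>2) * (4 * exp (- pi * l))"
proof -
  define f where "f = (\<lambda>m::int. complex_of_real (exp (- pi * l * (0 + of_int m)\<^sup>2)) * cis (2 * pi * (l * v) * (0 + of_int m)))"
  have *: "exp (- pi * l * x\<^sup>2) \<le> exp (- pi * l) * exp (- pi * l) ^ k" if "x\<^sup>2 = (real k + 1)\<^sup>2" for x k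
  proof -
    have "real k + 1 \<le> (real k + 1)\<^sup>2" by (simp add: power2_eq_square algebra_simps)
    hence "pi * l * (real k + 1) \<le> pi * l * x\<^sup>2" using l that by (intro mult_left_mono) auto
    thus ?thesis by (simp add: exp_of_nat_mult[symmetric] exp_add[symmetric] algebra_simps)
  qed
  have "norm (infsum f UNIV - (\<Sum>m=0..0. f m)) \<le> 2 * exp (- pi * l) / (1 - exp (- pi * l))"
  proof (rule two_sided_geometric_tail(2))
    show "norm (f (0 + 1 + int k)) \<le> exp (- pi * l) * exp (- pi * l) ^ k" for k
      using *[of "of_int (0 + 1 + int k)" k] by (simp add: f_def norm_mult add_ac)
    show "norm (f (0 - 1 - int k)) \<le> exp (- pi * l) * exp (- pi * l) ^ k" for k
      using *[of "of_int (0 - 1 - int k)" k] by (simp add: f_def norm_mult power2_eq_square algebra_simps)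
  qed (use l in auto)
  also have "\<dots> \<le> 4 * exp (- pi * l)"
    using exp_minus_pi_mult_le[OF l] by (intro exp_half_geometric_le) auto
  finally have "norm (infsum f UNIV - 1) \<le> 4 * exp (- pi * l)" by (simp add: f_def)
  hence "norm (complex_of_real (sqrt l * exp (pi * l * v\<^sup>2))) * norm (infsum f UNIV - 1)
           \<le> sqrt l * exp (pi * l * v\<^sup>2) * (4 * exp (- pi * l))"
    using l by (intro mult_mono) (auto simp: norm_mult)
  moreover have "theta_sum l v 0 - of_real (sqrt l * exp (pi * l * v\<^sup>2)) =
       complex_of_real (sqrt l * exp (pi * l * v\<^sup>2)) * (infsum f UNIV - 1)"
    using theta_transformation[of l 0 v] l by (simp add: f_def algebra_simps)
  ultimately show ?thesis by (simp only: norm_mult)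
qed

text \<open>
  At \<open>t = 1/2\<close> the transformed series runs over half-integers; the central block consists of those with
  absolute value below \<open>N\<close>, and the first omitted ones are \<open>\<plusminus>(N + 1/2)\<close>, where
  \<open>(N + 1/2)\<^sup>2 = 1/4 + N (N + 1)\<close>.
\<close>

lemma theta_sum_half_approx:
  assumes l: "l \<ge> 1"
  shows "norm (theta_sum l v (1/2) - of_real (sqrt l * exp (pi * l * v\<^sup>2)) *
           (\<Sum>m=-int N..int N - 1. of_real (exp (- pi * l * (1/2 + of_int m)\<^sup>2)) * cis (2 * pi * (l * v) * (1/2 + of_int m))))
           \<le> sqrt l * exp (pi * l * v\<^sup>2) * (4 * (exp (- pi * l / 4) * exp (- pi * l * (real N * (real N + 1)))))"
proof -
  define f where "f = (\<lambda>m::int. complex_of_real (exp (- pi * l * (1/2 + of_int m)\<^sup>2)) * cis (2 * pi * (l * v) * (1/2 + of_int m)))"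
  define B where "B = exp (- pi * l / 4) * exp (- pi * l * (real N * (real N + 1)))"
  have *: "exp (- pi * l * x\<^sup>2) \<le> B * exp (- pi * l) ^ k" if "x\<^sup>2 = (real k + real N + 1/2)\<^sup>2" for x k
  proof -
    have "real k \<le> real k * real k + 2 * real k * real N + real k" by simp
    hence "1/4 + real N * (real N + 1) + real k \<le> (real k + real N + 1/2)\<^sup>2"
      unfolding power2_eq_square by (simp add: algebra_simps)
    hence "pi * l * (1/4 + real N * (real N + 1) + real k) \<le> pi * l * x\<^sup>2"
      using l that by (intro mult_left_mono) auto
    thus ?thesis by (simp add: B_def exp_of_nat_mult[symmetric] exp_add[symmetric] algebra_simps)
  qed
  have "norm (infsum f UNIV - (\<Sum>m=-int N..int N - 1. f m)) \<le> 2 * B / (1 - exp (- pi * l))"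
  proof (rule two_sided_geometric_tail(2))
    show "norm (f (int N - 1 + 1 + int k)) \<le> B * exp (- pi * l) ^ k" for k
      using *[of "1/2 + of_int (int N - 1 + 1 + int k)" k] by (simp add: f_def norm_mult add_ac)
    show "norm (f (- int N - 1 - int k)) \<le> B * exp (- pi * l) ^ k" for k
      using *[of "1/2 + of_int (- int N - 1 - int k)" k] by (simp add: f_def norm_mult power2_eq_square algebra_simps)
  qed (use l in auto)
  also have "\<dots> \<le> 4 * B"
    using exp_minus_pi_mult_le[OF l] by (intro exp_half_geometric_le) (auto simp: B_def)
  finally have "norm (complex_of_real (sqrt l * exp (pi * l * v\<^sup>2))) * norm (infsum f UNIV - (\<Sum>m=-int N..int N - 1. f m))
           \<le> sqrt l * exp (pi * l * v\<^sup>2) * (4 * B)"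
    using l by (intro mult_mono) (auto simp: norm_mult)
  moreover have "theta_sum l v (1/2) - of_real (sqrt l * exp (pi * l * v\<^sup>2)) * (\<Sum>m=-int N..int N - 1. f m) =
       complex_of_real (sqrt l * exp (pi * l * v\<^sup>2)) * (infsum f UNIV - (\<Sum>m=-int N..int N - 1. f m))"
    using theta_transformation[of l "1/2" v] l unfolding f_def right_diff_distrib by simp
  ultimately show ?thesis by (simp only: norm_mult f_def B_def)
qed

section \<open>Euler products and the pentagonal number theorem\<close>

text \<open>
  The real value of \<open>(a;q)\<^sub>\<infinity>\<close>, for which inequalities can be stated.
\<close>

definition real_qpoch_inf :: "real \<Rightarrow> real \<Rightarrow> real" where
  "real_qpoch_inf a q = (\<Prod>k. 1 - a * q ^ k)"

text \<open>
  All factors lie in \<open>(0, 1]\<close>, and the lower bound is the Weierstrass inequality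
  \<open>\<Prod>(1 - x\<^sub>k) \<ge> 1 - \<Sum>x\<^sub>k\<close> together with a geometric sum.
\<close>

lemma real_qpoch_inf_facts:
  fixes a q :: real
  assumes q: "0 < q" "q < 1" and a: "0 \<le> a" "a < 1"
  shows real_qpoch_inf_LIMSEQ: "(\<lambda>n. \<Prod>k<n. 1 - a * q ^ k) \<longlonglongrightarrow> real_qpoch_inf a q"
    and qpoch_inf_eq_real_qpoch_inf: "qpoch_inf (of_real a) q = of_real (real_qpoch_inf a q)"
    and real_qpoch_inf_pos: "real_qpoch_inf a q > 0"
    and real_qpoch_inf_le_1: "real_qpoch_inf a q \<le> 1"
    and real_qpoch_inf_ge: "real_qpoch_inf a q \<ge> 1 - a / (1 - q)"
proof -
  define f where "f = (\<lambda>k. 1 - a * q ^ k)"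
  have aq: "0 \<le> a * q ^ k" "a * q ^ k < 1" for k
  proof -
    show "0 \<le> a * q ^ k" using q a by simp
    have "a * q ^ k \<le> a * 1" using q a by (intro mult_left_mono power_le_one) auto
    thus "a * q ^ k < 1" using a by simp
  qed
  have conv: "convergent_prod f"
  proof (intro abs_convergent_prod_imp_convergent_prod summable_imp_abs_convergent_prod)
    have "summable (\<lambda>k. a * q ^ k)" using q by (intro summable_mult summable_geometric) auto
    thus "summable (\<lambda>k. norm (f k - 1))" using aq by (simp add: f_def)
  qed
  have "(\<lambda>n. \<Prod>k\<le>n. f k) \<longlonglongrightarrow> prodinf f" by (rule convergent_prod_LIMSEQ[OF conv])
  hence lim: "(\<lambda>n. \<Prod>k<n. f k) \<longlonglongrightarrow> prodinf f"
    by (subst filterlim_sequentially_Suc[symmetric]) (simp add: lessThan_Suc_atMost)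
  thus "(\<lambda>n. \<Prod>k<n. 1 - a * q ^ k) \<longlonglongrightarrow> real_qpoch_inf a q" by (simp add: f_def real_qpoch_inf_def)
  have "(\<lambda>k. complex_of_real (f k)) has_prod of_real (prodinf f)"
    using conv by (simp add: convergent_prod_has_prod)
  thus "qpoch_inf (of_real a) q = of_real (real_qpoch_inf a q)"
    using has_prod_unique unfolding qpoch_inf_def real_qpoch_inf_def f_def by fastforce
  have f01: "0 < f k" "f k \<le> 1" for k using aq[of k] by (auto simp: f_def)
  have "(\<Prod>k<n. f k) \<le> 1" for n using f01 by (intro prod_le_1) (auto intro: less_imp_le)
  hence le1: "prodinf f \<le> 1" by (intro LIMSEQ_le_const2[OF lim]) auto
  thus "real_qpoch_inf a q \<le> 1" by (simp add: f_def real_qpoch_inf_def)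
  have "(\<Prod>k<n. f k) \<ge> 0" for n using f01 by (intro prod_nonneg) (auto intro: less_imp_le)
  hence "prodinf f \<ge> 0" by (intro LIMSEQ_le_const[OF lim]) auto
  moreover have "prodinf f \<noteq> 0" using f01 by (intro prodinf_nonzero[OF conv]) (metis less_irrefl)
  ultimately show "real_qpoch_inf a q > 0" by (simp add: f_def real_qpoch_inf_def)
  have "(\<Prod>k<n. f k) \<ge> 1 - a / (1 - q)" for n
  proof -
    have "(\<Prod>k<n. f k) \<ge> 1 - (\<Sum>k<n. a * q ^ k)"
    proof (induction n)
      case (Suc n)
      have "(\<Prod>k<n. f k) * (a * q ^ n) \<le> 1 * (a * q ^ n)"
        using f01 aq(1) by (intro mult_right_mono prod_le_1) (auto intro: less_imp_le)
      with Suc show ?case by (simp add: f_def algebra_simps)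
    qed simp
    moreover have "(\<Sum>k<n. a * q ^ k) \<le> a * (1 / (1 - q))"
      unfolding sum_distrib_left[symmetric] using q a
      by (intro mult_left_mono) (auto simp: sum_gp_strict divide_right_mono)
    ultimately show ?thesis by simp
  qed
  thus "real_qpoch_inf a q \<ge> 1 - a / (1 - q)"
    unfolding real_qpoch_inf_def f_def[symmetric] by (intro LIMSEQ_le_const[OF lim]) auto
qed

definition triangle :: "nat \<Rightarrow> nat" where "triangle n = (\<Sum>i\<le>n. i)"

lemma triangle_simps [simp]: "triangle 0 = 0" "triangle (Suc n) = triangle n + Suc n"
  by (auto simp: triangle_def)

text \<open>
  Shanks's finite form of the pentagonal number theorem. The left side satisfies the recursion of the right
  side because the change of each term from \<open>n\<close> to \<open>n + 1\<close> telescopes in \<open>s\<close>. The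
  exponents \<open>k (3 k \<plusminus> 1) / 2\<close> appear as \<open>k\<^sup>2\<close> plus a triangular number, which keeps them natural.
\<close>

lemma shanks_identity:
  fixes q :: real
  assumes q: "0 < q" "q < 1"
  defines "P \<equiv> (\<lambda>n. \<Prod>k<n. 1 - q * q ^ k)"
  shows "(\<Sum>s\<le>n. (-1) ^ s * (P n / P s) * q ^ (s * n + triangle s)) =
         1 + (\<Sum>k<n. (-1) ^ Suc k * (q ^ ((Suc k)\<^sup>2 + triangle (Suc k)) + q ^ ((Suc k)\<^sup>2 + triangle k)))"
proof (induction n)
  case (Suc n)
  have P_Suc: "P (Suc s) = P s * (1 - q * q ^ s)" for s by (simp add: P_def)
  have "q * q ^ k < 1" for k using q power_Suc_less_one[of q k] by simp
  hence fac: "1 - q * q ^ k \<noteq> 0" for k by (metis diff_gt_0_iff_gt less_irrefl)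
  hence P_nz: "P s \<noteq> 0" for s by (auto simp: P_def)
  define G where "G = (\<lambda>s. (-1) ^ s * (P n / P s) * q ^ (Suc s * Suc n + triangle s))"
  have telescope: "(-1) ^ s * (P (Suc n) / P s) * q ^ (s * Suc n + triangle s)
       - (-1) ^ s * (P n / P s) * q ^ (s * n + triangle s) =
       (case s of 0 \<Rightarrow> 0 | Suc r \<Rightarrow> G r) - G s" for s
  proof -
    define A where "A = (-1) ^ s * (P n / P s) * q ^ (s * n + triangle s)"
    have 1: "(-1) ^ s * (P (Suc n) / P s) * q ^ (s * Suc n + triangle s) = A * (1 - q * q ^ n) * q ^ s"
      by (simp add: A_def P_Suc power_add)
    have 2: "G s = A * q ^ s * (q * q ^ n)"
      by (simp add: A_def G_def power_add)
    have 3: "(case s of 0 \<Rightarrow> 0 | Suc r \<Rightarrow> G r) = - (A * (1 - q ^ s))"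
    proof (cases s)
      case (Suc r)
      show ?thesis
        using P_nz[of r] fac[of r] unfolding A_def G_def Suc P_Suc
        by (simp add: power_add field_simps)
    qed simp
    show ?thesis unfolding 1 2 3 A_def[symmetric] by algebra
  qed
  have "(\<Sum>s\<le>Suc n. (-1) ^ s * (P (Suc n) / P s) * q ^ (s * Suc n + triangle s)) =
        (\<Sum>s\<le>n. (-1) ^ s * (P (Suc n) / P s) * q ^ (s * Suc n + triangle s))
        + (-1) ^ Suc n * q ^ ((Suc n)\<^sup>2 + triangle (Suc n))"
    using P_nz[of "Suc n"] by (simp add: power2_eq_square)
  also have "(\<Sum>s\<le>n. (-1) ^ s * (P (Suc n) / P s) * q ^ (s * Suc n + triangle s)) =
       (\<Sum>s\<le>n. (-1) ^ s * (P n / P s) * q ^ (s * n + triangle s))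
       + (\<Sum>s\<le>n. (case s of 0 \<Rightarrow> 0 | Suc r \<Rightarrow> G r) - G s)"
    unfolding telescope[symmetric] by (simp add: sum_subtractf)
  also have "(\<Sum>s\<le>m. (case s of 0 \<Rightarrow> 0 | Suc r \<Rightarrow> G r) - G s) = - G m" for m
    by (induction m) auto
  also have "G n = (-1) ^ n * q ^ ((Suc n)\<^sup>2 + triangle n)"
    using P_nz[of n] by (simp add: G_def power2_eq_square)
  finally have step: "(\<Sum>s\<le>Suc n. (-1) ^ s * (P (Suc n) / P s) * q ^ (s * Suc n + triangle s)) =
     (\<Sum>s\<le>n. (-1) ^ s * (P n / P s) * q ^ (s * n + triangle s))
     + - ((-1) ^ n * q ^ ((Suc n)\<^sup>2 + triangle n)) + (-1) ^ Suc n * q ^ ((Suc n)\<^sup>2 + triangle (Suc n))" .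
  have regroup: "1 + S + - ((-1) ^ n * b) + (-1) ^ Suc n * a = 1 + (S + (-1) ^ Suc n * (a + b))"
    for S a b :: real by (simp add: algebra_simps)
  show ?case unfolding step Suc.IH sum.lessThan_Suc by (rule regroup)
qed (simp add: P_def)

text \<open>
  In Shanks's identity the term with \<open>s = 0\<close> is the finite product itself; each of the other \<open>n\<close> terms
  is at most \<open>q^n\<close>, so together they vanish in the limit.
\<close>

lemma euler_pentagonal:
  fixes q :: real
  assumes q: "0 < q" "q < 1"
  shows "(\<lambda>n. 1 + (\<Sum>k<n. (-1) ^ Suc k * (q ^ ((Suc k)\<^sup>2 + triangle (Suc k)) + q ^ ((Suc k)\<^sup>2 + triangle k))))
           \<longlonglongrightarrow> real_qpoch_inf q q"
proof -
  define P where "P = (\<lambda>n. \<Prod>k<n. 1 - q * q ^ k)"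
  have fac: "0 < 1 - q * q ^ k" "1 - q * q ^ k \<le> 1" for k
    using q power_Suc_less_one[of q k] by auto
  have P_pos: "P s > 0" for s unfolding P_def using fac by (intro prod_pos) auto
  have P_mono: "P n \<le> P s" if "s \<le> n" for s n
    using that
  proof (induction n rule: dec_induct)
    case (step n)
    have "P (Suc n) \<le> P n * 1" unfolding P_def prod.lessThan_Suc
      using fac P_pos[of n] by (intro mult_left_mono) (auto simp: P_def)
    with step show ?case by simp
  qed simp
  have "norm ((\<Sum>s\<le>n. (-1) ^ s * (P n / P s) * q ^ (s * n + triangle s)) - P n) \<le> real n * q ^ n" for n
  proof -
    have "(\<Sum>s\<le>n. (-1) ^ s * (P n / P s) * q ^ (s * n + triangle s)) - P n =
          (\<Sum>s<n. (-1) ^ Suc s * (P n / P (Suc s)) * q ^ (Suc s * n + triangle (Suc s)))"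
      by (subst sum.atMost_shift) (simp add: P_def)
    also have "norm \<dots> \<le> (\<Sum>s<n. q ^ n)"
    proof (rule sum_norm_le)
      fix s assume "s \<in> {..<n}"
      hence "P n / P (Suc s) \<le> 1" using P_mono[of "Suc s" n] P_pos by simp
      moreover have "q ^ (Suc s * n + triangle (Suc s)) \<le> q ^ n"
        using q by (intro power_decreasing) auto
      ultimately have "(P n / P (Suc s)) * q ^ (Suc s * n + triangle (Suc s)) \<le> 1 * q ^ n"
        using q P_pos by (intro mult_mono) (auto intro: less_imp_le)
      thus "norm ((-1) ^ Suc s * (P n / P (Suc s)) * q ^ (Suc s * n + triangle (Suc s))) \<le> q ^ n"
        using q P_pos[of n] P_pos[of "Suc s"] by (simp add: abs_mult power_abs)
    qed
    finally show ?thesis by simp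
  qed
  moreover have "(\<lambda>n. real n * q ^ n) \<longlonglongrightarrow> 0"
    using powser_times_n_limit_0[of q] q by simp
  ultimately have "(\<lambda>n. (\<Sum>s\<le>n. (-1) ^ s * (P n / P s) * q ^ (s * n + triangle s)) - P n) \<longlonglongrightarrow> 0"
    by (rule Lim_null_comparison[OF always_eventually[OF allI]])
  from tendsto_add[OF this real_qpoch_inf_LIMSEQ[of q q, folded P_def]] q
  have "(\<lambda>n. (\<Sum>s\<le>n. (-1) ^ s * (P n / P s) * q ^ (s * n + triangle s))) \<longlonglongrightarrow> real_qpoch_inf q q" by (simp add: P_def)
  thus ?thesis unfolding P_def shanks_identity[OF q] .
qed

section \<open>The size of Euler's function near the cusp\<close>

lemma real_triangle: "real (triangle k) = real k * (real k + 1) / 2"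
  by (induction k) (auto simp: field_simps)

text \<open>
  Completing the pentagonal exponents: \<open>q^(j (3 j - 1) / 2) = exp (- \<pi> j\<^sup>2 / (2 l / 3) + 2 \<pi> j / (4 l))\<close>.
\<close>

lemma euler_function_eq_theta_sum:
  assumes l: "l > 0" and q: "q = exp (- pi / l)"
  shows "of_real (real_qpoch_inf q q) = theta_sum (2 * l / 3) (1 / (4 * l)) (1/2)"
proof -
  define f where "f = (\<lambda>j::int. complex_of_real (exp (- pi * (of_int j)\<^sup>2 / (2 * l / 3) + 2 * pi * (1 / (4 * l)) * of_int j))
      * cis (2 * pi * of_int j * (1/2)))"
  have q01: "0 < q" "q < 1" using l by (auto simp: q)
  have "(\<lambda>j. norm (f j)) summable_on UNIV"
    unfolding f_def norm_mult norm_cis norm_of_real abs_exp_cancel mult_1_right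
    by (rule theta_term_summable_on) (use l in simp)
  hence "(f has_sum theta_sum (2 * l / 3) (1 / (4 * l)) (1/2)) UNIV"
    unfolding theta_sum_def f_def[symmetric] by (rule has_sum_infsum[OF abs_summable_summable])
  moreover have "filterlim (\<lambda>n. {- int n..int n}) (finite_subsets_at_top UNIV) sequentially"
  proof (rule filterlim_finite_int_sets)
    show "\<forall>\<^sub>F n in sequentially. {- int N..int N} \<subseteq> {- int n..int n}" for N
      using eventually_ge_at_top[of N] by eventually_elim auto
  qed auto
  ultimately have lim: "(\<lambda>n. \<Sum>j=-int n..int n. f j) \<longlonglongrightarrow> theta_sum (2 * l / 3) (1 / (4 * l)) (1/2)"
    unfolding has_sum_def by (rule filterlim_compose)
  have cis: "cis (2 * pi * of_int j * (1/2)) = (-1) ^ k" if "j = int k \<or> j = - int k" for j k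
  proof -
    have "cis (real k * pi) = (-1) ^ k" by (subst Complex.DeMoivre[symmetric]) simp
    moreover have "cis (- (real k * pi)) = (-1) ^ k"
      using arg_cong[OF calculation, of cnj] by (simp add: cis_cnj)
    ultimately show ?thesis using that by (auto simp: mult_ac)
  qed
  have f_pos: "f (int (Suc k)) = of_real ((-1) ^ Suc k * q ^ ((Suc k)\<^sup>2 + triangle k))" for k
  proof -
    have "- pi * (of_int (int (Suc k)))\<^sup>2 / (2 * l / 3) + 2 * pi * (1 / (4 * l)) * of_int (int (Suc k)) =
          real ((Suc k)\<^sup>2 + triangle k) * (- pi / l)"
      using l by (simp add: real_triangle field_simps power2_eq_square)
    hence "exp (- pi * (of_int (int (Suc k)))\<^sup>2 / (2 * l / 3) + 2 * pi * (1 / (4 * l)) * of_int (int (Suc k))) =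
           q ^ ((Suc k)\<^sup>2 + triangle k)"
      unfolding q by (simp only: exp_of_nat_mult)
    thus ?thesis unfolding f_def using cis[of "int (Suc k)" "Suc k"] by (simp only:) simp
  qed
  have f_neg: "f (- int (Suc k)) = of_real ((-1) ^ Suc k * q ^ ((Suc k)\<^sup>2 + triangle (Suc k)))" for k
  proof -
    have "- pi * (of_int (- int (Suc k)))\<^sup>2 / (2 * l / 3) + 2 * pi * (1 / (4 * l)) * of_int (- int (Suc k)) =
          real ((Suc k)\<^sup>2 + triangle (Suc k)) * (- pi / l)"
      using l by (simp add: real_triangle field_simps power2_eq_square)
    hence "exp (- pi * (of_int (- int (Suc k)))\<^sup>2 / (2 * l / 3) + 2 * pi * (1 / (4 * l)) * of_int (- int (Suc k))) =
           q ^ ((Suc k)\<^sup>2 + triangle (Suc k))"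
      unfolding q by (simp only: exp_of_nat_mult)
    thus ?thesis unfolding f_def using cis[of "- int (Suc k)" "Suc k"] by (simp only:) simp
  qed
  have "(\<Sum>j=-int n..int n. f j) = of_real (1 + (\<Sum>k<n. (-1) ^ Suc k *
          (q ^ ((Suc k)\<^sup>2 + triangle (Suc k)) + q ^ ((Suc k)\<^sup>2 + triangle k))))" for n
  proof (induction n)
    case (Suc n)
    have "{- int (Suc n)..int (Suc n)} = insert (- int (Suc n)) (insert (int (Suc n)) {- int n..int n})"
      by auto
    hence "(\<Sum>j=-int (Suc n)..int (Suc n). f j) = f (- int (Suc n)) + (f (int (Suc n)) + (\<Sum>j=-int n..int n. f j))"
      by simp
    thus ?case unfolding f_pos f_neg Suc by (simp add: algebra_simps)
  qed (simp add: f_def)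
  hence "(\<lambda>n. \<Sum>j=-int n..int n. f j) \<longlonglongrightarrow> of_real (real_qpoch_inf q q)"
    using tendsto_of_real[OF euler_pentagonal[OF q01], where ?'a = complex] by (simp only:)
  thus ?thesis using lim LIMSEQ_unique by blast
qed

text \<open>
  The modular transformation of the Dedekind eta function, up to an exponentially small relative error.
  For the parameters of \<open>euler_function_eq_theta_sum\<close> the product of scale and shift is \<open>1/6\<close>, so the
  half-integers \<open>\<plusminus>1/2\<close> contribute \<open>2 cos (\<pi>/6) = \<surd>3\<close> and \<open>\<plusminus>3/2\<close> contribute
  \<open>2 cos (\<pi>/2) = 0\<close>. The first error term therefore comes from \<open>\<plusminus>5/2\<close>, whence \<open>N = 2\<close>.
\<close>

lemma euler_function_approx:
  assumes l: "l \<ge> 3/2" and q: "q = exp (- pi / l)"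
  defines "T \<equiv> sqrt (2 * l) * exp (pi / (24 * l) - pi * l / 6)"
  shows "\<bar>real_qpoch_inf q q - T\<bar> \<le> T * (4 * exp (- 4 * pi * l))"
proof -
  define h where "h = 2 * l / 3"
  define v where "v = 1 / (4 * l)"
  have hv: "h * v = 1/6" using l by (simp add: h_def v_def)
  have hv2: "pi * h * v\<^sup>2 = pi / (24 * l)" using l by (simp add: h_def v_def power2_eq_square field_simps)
  define f where "f = (\<lambda>m::int. complex_of_real (exp (- pi * h * (1/2 + of_int m)\<^sup>2)) * cis (2 * pi * (h * v) * (1/2 + of_int m)))"
  have set_eq: "{- int 2..int 2 - 1} = {-2, -1, 0, 1}" by auto
  have "(\<Sum>m=-int 2..int 2 - 1. f m) = f (-2) + f (-1) + f 0 + f 1"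
    unfolding set_eq by simp
  also have "\<dots> = of_real (sqrt 3 * exp (- pi * h / 4))"
    unfolding f_def hv
    by (simp add: complex_eq_iff power2_eq_square cos_30 sin_30 field_simps)
  finally have main: "(\<Sum>m=-int 2..int 2 - 1. f m) = of_real (sqrt 3 * exp (- pi * h / 4))" .
  have "norm (of_real (real_qpoch_inf q q) - of_real (sqrt h * exp (pi * h * v\<^sup>2)) * complex_of_real (sqrt 3 * exp (- pi * h / 4)))
          \<le> sqrt h * exp (pi * h * v\<^sup>2) * (4 * (exp (- pi * h / 4) * exp (- pi * h * (real 2 * (real 2 + 1)))))"
    using theta_sum_half_approx[of h v 2] l
    unfolding f_def[symmetric] main
    by (simp add: euler_function_eq_theta_sum[OF _ q] h_def v_def)
  moreover have T: "T = sqrt h * exp (pi * h * v\<^sup>2) * (sqrt 3 * exp (- pi * h / 4))"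
  proof -
    have "sqrt (2 * l) = sqrt h * sqrt 3" by (simp add: h_def real_sqrt_mult[symmetric])
    moreover have "exp (pi / (24 * l) - pi * l / 6) = exp (pi * h * v\<^sup>2) * exp (- pi * h / 4)"
      unfolding hv2 exp_add[symmetric] by (simp add: h_def)
    ultimately show ?thesis by (simp add: T_def)
  qed
  ultimately have "\<bar>real_qpoch_inf q q - T\<bar>
     \<le> sqrt h * exp (pi * h * v\<^sup>2) * (4 * (exp (- pi * h / 4) * exp (- pi * h * (real 2 * (real 2 + 1)))))"
    by (simp only: of_real_mult[symmetric] of_real_diff[symmetric] norm_of_real)
  also have "exp (- pi * h * (real 2 * (real 2 + 1))) = exp (- 4 * pi * l)"
    by (simp add: h_def)
  also have "sqrt h * exp (pi * h * v\<^sup>2) * (4 * (exp (- pi * h / 4) * exp (- 4 * pi * l)))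
      \<le> T * (4 * exp (- 4 * pi * l))"
  proof -
    have "sqrt h * exp (pi * h * v\<^sup>2) * (1 * exp (- pi * h / 4)) \<le> T"
      unfolding T using l by (intro mult_left_mono mult_right_mono) (auto simp: h_def)
    hence "sqrt h * exp (pi * h * v\<^sup>2) * (1 * exp (- pi * h / 4)) * (4 * exp (- 4 * pi * l)) \<le> T * (4 * exp (- 4 * pi * l))"
      by (intro mult_right_mono) auto
    thus ?thesis by (simp add: mult_ac)
  qed
  finally show ?thesis .
qed

lemma exp_minus_4pi_le:
  assumes "l \<ge> 1"
  shows "exp (- 4 * pi * l) \<le> 1 / 16"
proof -
  have "exp (- 4 * pi * l) = exp (- pi * l) ^ 4"
    by (simp add: exp_of_nat_mult[symmetric])
  also have "\<dots> \<le> (1/2) ^ 4"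
    using exp_minus_pi_mult_le[OF assms] by (intro power_mono) auto
  finally show ?thesis by (simp add: power_divide)
qed

text \<open>
  The square of the inverse appears in the Bessel prefactor. If the ratio \<open>\<rho>\<close> of exact to leading value
  is within \<open>\<epsilon> \<le> 1/2\<close> of \<open>1\<close>, then \<open>\<bar>\<rho>\<^sup>-\<^sup>2 - 1\<bar> \<le> \<epsilon> (5/2) / (1/4)\<close>.
\<close>

lemma inverse_euler_function_square_approx:
  assumes l: "l \<ge> 3/2" and q: "q = exp (- pi / l)"
  shows "\<bar>2 * l * exp (pi / (12 * l) - pi * l / 3) / (real_qpoch_inf q q)\<^sup>2 - 1\<bar> \<le> 40 * exp (- 4 * pi * l)"
proof -
  define T where "T = sqrt (2 * l) * exp (pi / (24 * l) - pi * l / 6)"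
  define Q where "Q = real_qpoch_inf q q"
  define \<epsilon> where "\<epsilon> = 4 * exp (- 4 * pi * l)"
  define \<rho> where "\<rho> = Q / T"
  have T: "T > 0" using l by (simp add: T_def)
  have eps: "0 \<le> \<epsilon>" "\<epsilon> \<le> 1/2" using exp_minus_4pi_le[of l] l by (auto simp: \<epsilon>_def)
  have "\<bar>Q - T\<bar> \<le> T * \<epsilon>"
    using euler_function_approx[OF l q] by (simp add: T_def Q_def \<epsilon>_def)
  moreover have "\<bar>Q - T\<bar> = T * \<bar>\<rho> - 1\<bar>"
  proof -
    have "Q - T = T * (\<rho> - 1)" using T by (simp add: \<rho>_def field_simps)
    thus ?thesis using T by (simp only: abs_mult abs_of_pos)
  qed
  ultimately have rho: "\<bar>\<rho> - 1\<bar> \<le> \<epsilon>" using T by simp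
  hence rho2: "1/2 \<le> \<rho>" "\<rho> \<le> 3/2" using eps by linarith+
  have "2 * l * exp (pi / (12 * l) - pi * l / 3) = T\<^sup>2"
    using l by (simp add: T_def power_mult_distrib exp_double[symmetric] algebra_simps)
  hence "2 * l * exp (pi / (12 * l) - pi * l / 3) / (real_qpoch_inf q q)\<^sup>2 - 1 = (1 - \<rho>) * ((1 + \<rho>) / \<rho>\<^sup>2)"
    using T rho2 by (simp add: Q_def[symmetric] \<rho>_def field_simps power2_eq_square)
  moreover have "\<bar>(1 - \<rho>) * ((1 + \<rho>) / \<rho>\<^sup>2)\<bar> \<le> \<epsilon> * 10"
    unfolding abs_mult
  proof (rule mult_mono)
    have "(1/2)\<^sup>2 \<le> \<rho>\<^sup>2" using rho2 by (intro power_mono) auto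
    hence "(1 + \<rho>) / \<rho>\<^sup>2 \<le> (5/2) / (1/2)\<^sup>2" using rho2 by (intro frac_le) auto
    thus "\<bar>(1 + \<rho>) / \<rho>\<^sup>2\<bar> \<le> 10" using rho2 by (simp add: power2_eq_square)
  qed (use rho eps in auto)
  ultimately show ?thesis by (simp add: \<epsilon>_def)
qed

section \<open>The Bessel series as a truncated theta series\<close>

text \<open>
  At \<open>t = 0\<close> the terms are positive, so this theta value majorises every weighted or alternating one
  with the same \<open>v\<close>.
\<close>

lemma theta_sum_0_has_sum:
  assumes "l > 0"
  shows "((\<lambda>j::int. exp (- pi * (of_int j)\<^sup>2 / l + 2 * pi * v * of_int j)) has_sum Re (theta_sum l v 0)) UNIV"
proof -
  have "((\<lambda>j::int. complex_of_real (exp (- pi * (of_int j)\<^sup>2 / l + 2 * pi * v * of_int j))) has_sum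
     of_real (\<Sum>\<^sub>\<infinity>j::int. exp (- pi * (of_int j)\<^sup>2 / l + 2 * pi * v * of_int j))) UNIV"
    by (intro has_sum_of_real has_sum_infsum theta_term_summable_on assms)
  moreover from this have "theta_sum l v 0 = of_real (\<Sum>\<^sub>\<infinity>j::int. exp (- pi * (of_int j)\<^sup>2 / l + 2 * pi * v * of_int j))"
    unfolding theta_sum_def by (intro infsumI) simp
  ultimately show ?thesis
    using has_sum_infsum[OF theta_term_summable_on[OF assms, of v]] by simp
qed

lemma theta_sum_0_le:
  assumes l: "l \<ge> 1"
  shows "Re (theta_sum l v 0) \<le> 3 * (sqrt l * exp (pi * l * v\<^sup>2))"
proof -
  define W where "W = sqrt l * exp (pi * l * v\<^sup>2)"
  have W: "W \<ge> 0" using l by (simp add: W_def)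
  have "Re (theta_sum l v 0 - of_real W) \<le> norm (theta_sum l v 0 - of_real W)"
    by (rule complex_Re_le_cmod)
  also have "\<dots> \<le> W * (4 * exp (- pi * l))"
    unfolding W_def by (rule theta_sum_0_approx[OF l])
  also have "\<dots> \<le> W * (4 * (1/2))"
    using W exp_minus_pi_mult_le[OF l] by (intro mult_left_mono) auto
  finally show ?thesis by (simp add: W_def)
qed

text \<open>
  The weights are close to \<open>1\<close> for \<open>j = k - 2n \<ge> -n\<close>. For \<open>j < -n\<close> the error of the weight, at most
  \<open>1\<close>, is bounded by \<open>exp (- 2 \<pi> (n + j))\<close>; this exponential tilt changes \<open>v\<close> into \<open>v - 1\<close>, so the
  tail is again bounded by a full theta value and needs no separate estimate.
\<close>

lemma truncated_theta_sum:
  fixes b :: "nat \<Rightarrow> real" and n :: nat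
  assumes l: "l > 0"
    and b: "\<And>k. 0 \<le> b k" "\<And>k. b k \<le> 1" "\<And>k. n \<le> k \<Longrightarrow> 1 - \<delta> \<le> b k"
  obtains S where
    "(\<lambda>k. of_real (b k * exp (- pi * (real k - 2 * real n)\<^sup>2 / l + 2 * pi * v * (real k - 2 * real n)))
        * cis (2 * pi * (real k - 2 * real n) * t)) sums S"
    "norm (S - theta_sum l v t) \<le> \<delta> * Re (theta_sum l v 0) + exp (- 2 * pi * real n) * Re (theta_sum l (v - 1) 0)"
proof -
  define g where "g = (\<lambda>v (j::int). exp (- pi * (of_int j)\<^sup>2 / l + 2 * pi * v * of_int j))"
  define B where "B = (\<lambda>j::int. if - 2 * int n \<le> j then b (nat (j + 2 * int n)) else 0)"
  define f where "f = (\<lambda>j::int. complex_of_real (B j * g v j) * cis (2 * pi * of_int j * t))"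
  define e where "e = (\<lambda>j::int. complex_of_real (g v j) * cis (2 * pi * of_int j * t))"
  have g_sum: "(g w has_sum Re (theta_sum l w 0)) UNIV" for w
    unfolding g_def by (rule theta_sum_0_has_sum[OF l])
  have B01: "0 \<le> B j" "B j \<le> 1" for j using b by (auto simp: B_def)
  have g_pos: "g w j > 0" for w j by (simp add: g_def)
  have dom: "(\<lambda>j. norm (h j)) summable_on UNIV" if "\<And>j. norm (h j) \<le> g v j" for h :: "int \<Rightarrow> complex"
    by (rule summable_on_comparison_test[OF has_sum_imp_summable[OF g_sum]]) (use that in auto)
  have "norm (f j) \<le> g v j" for j
    using B01[of j] g_pos[of v j] by (simp add: f_def norm_mult abs_mult mult_left_le_one_le)
  hence f_sum: "(f has_sum infsum f UNIV) UNIV"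
    by (rule has_sum_infsum[OF abs_summable_summable[OF dom]])
  have "norm (e j) \<le> g v j" for j
    using g_pos[of v j] by (simp add: e_def norm_mult)
  hence e_sum: "(e has_sum theta_sum l v t) UNIV"
    unfolding theta_sum_def g_def[symmetric] e_def[symmetric]
    using has_sum_infsum[OF abs_summable_summable[OF dom[of e]]] by (simp add: e_def g_def)
  have "(f has_sum infsum f UNIV) UNIV \<longleftrightarrow> (f has_sum infsum f UNIV) {- 2 * int n..}"
    by (rule has_sum_cong_neutral) (auto simp: f_def B_def)
  with f_sum have "(f has_sum infsum f UNIV) {- 2 * int n..}" by simp
  moreover have "bij_betw (\<lambda>k. int k - 2 * int n) UNIV {- 2 * int n..}"
    by (rule bij_betwI[where g = "\<lambda>j. nat (j + 2 * int n)"]) auto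
  ultimately have "((\<lambda>k. f (int k - 2 * int n)) has_sum infsum f UNIV) UNIV"
    using has_sum_reindex_bij_betw by blast
  hence 1: "(\<lambda>k. f (int k - 2 * int n)) sums infsum f UNIV"
    by (rule has_sum_imp_sums)
  have 2: "norm (infsum f UNIV - theta_sum l v t)
      \<le> \<delta> * Re (theta_sum l v 0) + exp (- 2 * pi * real n) * Re (theta_sum l (v - 1) 0)"
  proof (rule norm_infsum_le)
    show "((\<lambda>j. f j - e j) has_sum (infsum f UNIV - theta_sum l v t)) UNIV"
      using has_sum_add[OF f_sum, of "\<lambda>j. - e j" "- theta_sum l v t"] e_sum by (simp add: has_sum_uminus)
    show "((\<lambda>j. \<delta> * g v j + exp (- 2 * pi * real n) * g (v - 1) j) has_sum
        (\<delta> * Re (theta_sum l v 0) + exp (- 2 * pi * real n) * Re (theta_sum l (v - 1) 0))) UNIV"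
      by (intro has_sum_add has_sum_cmult_right g_sum)
    fix j :: int
    have shift: "exp (- 2 * pi * real n) * g (v - 1) j = exp (- 2 * pi * (real n + of_int j)) * g v j"
      by (simp add: g_def exp_add[symmetric] algebra_simps)
    have "\<bar>B j - 1\<bar> \<le> \<delta> + exp (- 2 * pi * (real n + of_int j))"
    proof (cases "- int n \<le> j")
      case True
      hence "n \<le> nat (j + 2 * int n)" "- 2 * int n \<le> j" by auto
      hence "1 - \<delta> \<le> B j" using b(3) by (simp add: B_def)
      hence "\<bar>B j - 1\<bar> \<le> \<delta>" using B01[of j] by linarith
      also have "\<dots> \<le> \<delta> + exp (- 2 * pi * (real n + of_int j))" by simp
      finally show ?thesis .
    next
      case False
      have "\<delta> \<ge> 0" using b(2,3)[of n] by simp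
      have "real n + of_int j \<le> 0" using False by linarith
      hence "exp (- 2 * pi * (real n + of_int j)) \<ge> 1" by (simp add: mult_nonneg_nonpos)
      thus ?thesis using B01[of j] \<open>\<delta> \<ge> 0\<close> by linarith
    qed
    hence "\<bar>B j - 1\<bar> * g v j \<le> (\<delta> + exp (- 2 * pi * (real n + of_int j))) * g v j"
      using g_pos[of v j] by (intro mult_right_mono) auto
    moreover have "norm (f j - e j) = \<bar>B j - 1\<bar> * g v j"
    proof -
      have "f j - e j = complex_of_real ((B j - 1) * g v j) * cis (2 * pi * of_int j * t)"
        by (simp add: f_def e_def algebra_simps)
      thus ?thesis using g_pos[of v j] by (simp only: norm_mult norm_of_real abs_mult) simp
    qed
    ultimately show "norm (f j - e j) \<le> \<delta> * g v j + exp (- 2 * pi * real n) * g (v - 1) j"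
      unfolding shift by (simp only: distrib_right)
  qed
  have "f (int k - 2 * int n) = of_real (b k * exp (- pi * (real k - 2 * real n)\<^sup>2 / l + 2 * pi * v * (real k - 2 * real n)))
        * cis (2 * pi * (real k - 2 * real n) * t)" for k
    by (simp add: f_def B_def g_def)
  with 1 2 that show ?thesis by simp
qed

lemma qpoch_of_real:
  fixes a q :: real
  assumes "0 < q" "q < 1" "0 \<le> a" "a < 1"
  shows "qpoch (of_real a) q k = of_real (real_qpoch_inf a q / real_qpoch_inf (a * q ^ k) q)"
proof -
  have "a * q ^ k \<le> a * 1" using assms by (intro mult_left_mono power_le_one) auto
  thus ?thesis unfolding qpoch_def
    using qpoch_inf_eq_real_qpoch_inf[of q a] qpoch_inf_eq_real_qpoch_inf[of q "a * q ^ k"] assms by simp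
qed

text \<open>
  The factor \<open>A(k)\<close> left over when \<open>1 / (q, q\<^bsup>\<nu>+1\<^esup>; q)\<^sub>k\<close> is written with infinite products.
\<close>

definition bessel_weight :: "real \<Rightarrow> real \<Rightarrow> nat \<Rightarrow> real" where
  "bessel_weight \<nu> q k = real_qpoch_inf (q * q ^ k) q * real_qpoch_inf (q powr (\<nu> + 1) * q ^ k) q"

text \<open>
  For factors in \<open>[0, 1]\<close> one has \<open>Q1 Q2 \<ge> Q1 + Q2 - 1\<close>, and for \<open>k \<ge> n\<close> both base points are at
  most \<open>q^n\<close>; here \<open>\<nu> > -1\<close> is used for the second one.
\<close>

lemma bessel_weight_bounds:
  assumes q: "0 < q" "q < 1" and nu: "\<nu> > -1"
  shows "0 \<le> bessel_weight \<nu> q k" "bessel_weight \<nu> q k \<le> 1"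
    and "n \<le> k \<Longrightarrow> 1 - 2 * (q ^ n / (1 - q)) \<le> bessel_weight \<nu> q k"
proof -
  define a1 a2 where "a1 = q * q ^ k" and "a2 = q powr (\<nu> + 1) * q ^ k"
  have qn: "q powr (\<nu> + 1) < 1" "q powr (\<nu> + 1) > 0" using q nu powr01_less_one[of q "\<nu> + 1"] by auto
  have a: "0 \<le> a1" "a1 < 1" "0 \<le> a2" "a2 < 1"
  proof -
    have "a1 \<le> q * 1" "a2 \<le> q powr (\<nu> + 1) * 1"
      unfolding a1_def a2_def using q by (intro mult_left_mono power_le_one; simp)+
    thus "a1 < 1" "a2 < 1" using q qn by auto
  qed (use q in \<open>auto simp: a1_def a2_def\<close>)
  define Q1 Q2 where "Q1 = real_qpoch_inf a1 q" and "Q2 = real_qpoch_inf a2 q"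
  have w: "bessel_weight \<nu> q k = Q1 * Q2" by (simp add: bessel_weight_def Q1_def Q2_def a1_def a2_def)
  have Q: "0 < Q1" "Q1 \<le> 1" "0 < Q2" "Q2 \<le> 1"
    using real_qpoch_inf_pos real_qpoch_inf_le_1 q a by (auto simp: Q1_def Q2_def)
  show "0 \<le> bessel_weight \<nu> q k" "bessel_weight \<nu> q k \<le> 1"
    using Q by (auto simp: w mult_le_one)
  assume "n \<le> k"
  hence "q ^ k \<le> q ^ n" using q by (intro power_decreasing) auto
  moreover have "a1 \<le> 1 * q ^ k" "a2 \<le> 1 * q ^ k"
    unfolding a1_def a2_def using q qn by (intro mult_right_mono; simp)+
  ultimately have "a1 \<le> q ^ n" "a2 \<le> q ^ n" by linarith+
  hence "a1 / (1 - q) \<le> q ^ n / (1 - q)" "a2 / (1 - q) \<le> q ^ n / (1 - q)"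
    using q by (auto intro!: divide_right_mono)
  moreover have "1 - a1 / (1 - q) \<le> Q1" "1 - a2 / (1 - q) \<le> Q2"
    unfolding Q1_def Q2_def using real_qpoch_inf_ge q a by blast+
  moreover have "0 \<le> (1 - Q1) * (1 - Q2)" using Q by simp
  hence "Q1 + Q2 - 1 \<le> Q1 * Q2" by (simp add: algebra_simps)
  ultimately show "1 - 2 * (q ^ n / (1 - q)) \<le> bessel_weight \<nu> q k"
    unfolding w by linarith
qed

text \<open>
  Here \<open>exp L = \<surd>(z q\<^bsup>-\<nu>\<^esup>) q\<^bsup>-2n\<^esup>\<close> and \<open>\<iota>\<close> is the direction of the argument, to be taken as
  \<open>\<i>\<close> or \<open>1\<close>. The sign \<open>(-1)^k\<close> of the Bessel series and the phase of \<open>\<iota>\<close> combine to \<open>c\<close> times a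
  character: trivial (\<open>t = 0\<close>) for \<open>\<iota> = \<i>\<close>, where the signs cancel, and alternating (\<open>t = 1/2\<close>)
  for \<open>\<iota> = 1\<close>. The real part of each term follows by completing the square around \<open>k = 2n\<close>.
\<close>

lemma q_bessel2_eq_truncated_theta:
  fixes l \<nu> v t q L :: real and n :: nat and \<iota> c S :: complex
  assumes l: "l > 0" and nu: "\<nu> > -1" and q: "q = exp (- pi / l)"
    and L: "L = pi * v + pi * \<nu> / (2 * l) + 2 * pi * real n / l"
    and iota: "\<iota> \<noteq> 0" "\<And>k. (-1) ^ k * \<iota> powr of_real (2 * real k + \<nu>) = c * cis (2 * pi * (real k - 2 * real n) * t)"
    and S: "(\<lambda>k. of_real (bessel_weight \<nu> q k * exp (- pi * (real k - 2 * real n)\<^sup>2 / l + 2 * pi * v * (real k - 2 * real n)))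
        * cis (2 * pi * (real k - 2 * real n) * t)) sums S"
  shows "q_bessel2 \<nu> (2 * \<iota> * of_real (exp L)) q =
     c * of_real (exp (\<nu> * L + 4 * pi * (real n)\<^sup>2 / l + 4 * pi * v * real n) / (real_qpoch_inf q q)\<^sup>2) * S"
proof -
  have q01: "0 < q" "q < 1" using l by (auto simp: q)
  define a where "a = q powr (\<nu> + 1)"
  have a: "0 \<le> a" "a < 1" "0 < a" unfolding a_def using q01 nu powr01_less_one[of q "\<nu> + 1"] by auto
  have Qq: "real_qpoch_inf q q > 0" and Qa: "real_qpoch_inf a q > 0"
    using real_qpoch_inf_pos q01 a by auto
  define M where "M = exp (\<nu> * L + 4 * pi * (real n)\<^sup>2 / l + 4 * pi * v * real n)"
  define g where "g = (\<lambda>k. exp (- pi * (real k - 2 * real n)\<^sup>2 / l + 2 * pi * v * (real k - 2 * real n)))"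
  define T where "T = (\<lambda>k. of_real (bessel_weight \<nu> q k * g k) * cis (2 * pi * (real k - 2 * real n) * t))"
  have arg: "(2 * \<iota> * of_real (exp L) / 2) powr of_real (2 * real k + \<nu>) =
        of_real (exp ((2 * real k + \<nu>) * L)) * \<iota> powr of_real (2 * real k + \<nu>)" for k
  proof -
    have "Ln (of_real (exp L) * \<iota>) = of_real L + Ln \<iota>"
      using Ln_times_of_real[of "exp L" \<iota>] iota(1) by (simp add: Ln_of_real)
    hence "(of_real (exp L) * \<iota>) powr of_real (2 * real k + \<nu>) =
        exp (of_real (2 * real k + \<nu>) * (of_real L + Ln \<iota>))"
      using iota(1) by (simp add: powr_def)
    also have "\<dots> = of_real (exp ((2 * real k + \<nu>) * L)) * \<iota> powr of_real (2 * real k + \<nu>)"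
      using iota(1) by (simp add: powr_def distrib_left exp_add flip: exp_of_real)
    finally show ?thesis by (simp add: mult.commute)
  qed
  have real_part: "q powr ((real k)\<^sup>2 + real k * \<nu>) * exp ((2 * real k + \<nu>) * L) = M * g k" for k
    using l by (simp add: q L M_def g_def exp_powr_real exp_add[symmetric])
       (simp add: power2_eq_square field_simps)
  have "of_real (q powr ((real k)\<^sup>2 + real k * \<nu>)) * (-1) ^ k
          / (qpoch (of_real q) q k * qpoch (of_real (q powr (\<nu> + 1))) q k)
          * (2 * \<iota> * of_real (exp L) / 2) powr of_real (2 * real k + \<nu>)
      = c * of_real (M / (real_qpoch_inf q q * real_qpoch_inf a q)) * T k" for k
  proof -
    have qp: "qpoch (of_real q) q k * qpoch (of_real (q powr (\<nu> + 1))) q k =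
          of_real (real_qpoch_inf q q * real_qpoch_inf a q / bessel_weight \<nu> q k)"
      using qpoch_of_real[of q q k] qpoch_of_real[of q a k] q01 a
      by (simp add: bessel_weight_def a_def)
    have "of_real (q powr ((real k)\<^sup>2 + real k * \<nu>)) * (-1) ^ k
          / (qpoch (of_real q) q k * qpoch (of_real (q powr (\<nu> + 1))) q k)
          * (2 * \<iota> * of_real (exp L) / 2) powr of_real (2 * real k + \<nu>)
      = of_real (q powr ((real k)\<^sup>2 + real k * \<nu>) * exp ((2 * real k + \<nu>) * L) * bessel_weight \<nu> q k
           / (real_qpoch_inf q q * real_qpoch_inf a q)) * ((-1) ^ k * \<iota> powr of_real (2 * real k + \<nu>))"
      unfolding qp arg by simp
    also have "\<dots> = c * of_real (M / (real_qpoch_inf q q * real_qpoch_inf a q)) * T k"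
      unfolding real_part iota(2) T_def by simp
    finally show ?thesis .
  qed
  moreover have "(\<lambda>k. c * of_real (M / (real_qpoch_inf q q * real_qpoch_inf a q)) * T k) sums
      (c * of_real (M / (real_qpoch_inf q q * real_qpoch_inf a q)) * S)"
    using S unfolding T_def g_def by (rule sums_mult)
  ultimately have "(\<Sum>k. of_real (q powr ((real k)\<^sup>2 + real k * \<nu>)) * (-1) ^ k
          / (qpoch (of_real q) q k * qpoch (of_real (q powr (\<nu> + 1))) q k)
          * (2 * \<iota> * of_real (exp L) / 2) powr of_real (2 * real k + \<nu>))
      = c * of_real (M / (real_qpoch_inf q q * real_qpoch_inf a q)) * S"
    by (simp only: sums_unique[symmetric])
  moreover have "qpoch_inf (of_real (q powr (\<nu> + 1))) q / qpoch_inf (of_real q) q =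
      of_real (real_qpoch_inf a q / real_qpoch_inf q q)"
    using qpoch_inf_eq_real_qpoch_inf q01 a unfolding a_def by simp
  ultimately show ?thesis
    unfolding q_bessel2_def M_def[symmetric] using Qq Qa
    by (simp add: power2_eq_square)
qed

section \<open>Asymptotics of the Bessel function\<close>

text \<open>
  From \<open>exp x \<ge> 1 + x\<close> one gets \<open>1 / (1 - exp (- x)) \<le> 1 + 1/x\<close> with \<open>x = \<pi> / l\<close>, which grows only
  linearly in \<open>l\<close>.
\<close>

lemma inverse_one_minus_exp_le:
  assumes "l > 0"
  shows "1 / (1 - exp (- pi / l)) \<le> exp (pi * l)"
proof -
  define x where "x = pi / l"
  have x: "x > 0" using assms by (simp add: x_def)
  have "1 + x \<le> exp x" by (rule exp_ge_add_one_self)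
  hence "exp (- x) \<le> 1 / (1 + x)" using x by (simp add: exp_minus field_simps)
  hence "x / (1 + x) \<le> 1 - exp (- x)" using x by (simp add: field_simps)
  hence "1 / (1 - exp (- x)) \<le> 1 / (x / (1 + x))" using x by (intro divide_left_mono) auto
  also have "\<dots> = 1 + l / pi" using x assms by (simp add: x_def field_simps)
  also have "l / pi \<le> pi * l"
  proof -
    have "l * 1 \<le> l * (pi * pi)" using assms pi_gt3 mult_mono[of 1 pi 1 pi] by (intro mult_left_mono) auto
    thus ?thesis by (simp add: field_simps)
  qed
  also have "1 + pi * l \<le> exp (pi * l)" by (rule exp_ge_add_one_self)
  finally show ?thesis by (simp add: x_def)
qed

text \<open>
  The size of \<open>n\<close> makes both errors of \<open>truncated_theta_sum\<close> at most a multiple of \<open>exp (- 4 \<pi> l)\<close>. The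
  weight error is at most \<open>2 exp (- 5 \<pi> l) exp (\<pi> l)\<close> because \<open>n / l \<ge> 5 l\<close>. The tail carries the
  quotient \<open>exp (\<pi> l (1 - 2 v))\<close> of the Gaussians at \<open>v - 1\<close> and \<open>v\<close>, which the summand \<open>2 B\<close>
  compensates.
\<close>

lemma bessel_sum_approx:
  fixes l \<nu> v t q B :: real and n :: nat
  assumes l: "l \<ge> 3/2" and nu: "\<nu> > -1" and q: "q = exp (- pi / l)"
    and v: "\<bar>v\<bar> \<le> B" and n: "(5 + 2 * B) * l\<^sup>2 \<le> real n"
  obtains S where
    "(\<lambda>k. of_real (bessel_weight \<nu> q k * exp (- pi * (real k - 2 * real n)\<^sup>2 / l + 2 * pi * v * (real k - 2 * real n)))
        * cis (2 * pi * (real k - 2 * real n) * t)) sums S"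
    "norm (S - theta_sum l v t) \<le> sqrt l * exp (pi * l * v\<^sup>2) * (9 * exp (- 4 * pi * l))"
proof -
  have l0: "l > 0" "l \<ge> 1" using l by auto
  have B: "B \<ge> 0" using v by linarith
  have q01: "0 < q" "q < 1" using l0 by (auto simp: q)
  define \<delta> where "\<delta> = 2 * (q ^ n / (1 - q))"
  obtain S where
    S: "(\<lambda>k. of_real (bessel_weight \<nu> q k * exp (- pi * (real k - 2 * real n)\<^sup>2 / l + 2 * pi * v * (real k - 2 * real n)))
        * cis (2 * pi * (real k - 2 * real n) * t)) sums S" and
    bound: "norm (S - theta_sum l v t) \<le> \<delta> * Re (theta_sum l v 0) + exp (- 2 * pi * real n) * Re (theta_sum l (v - 1) 0)"
    unfolding \<delta>_def
    by (rule truncated_theta_sum[OF l0(1) bessel_weight_bounds[OF q01 nu]])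
  define W where "W = sqrt l * exp (pi * l * v\<^sup>2)"
  have W: "W > 0" using l0 by (simp add: W_def)
  have "l * l \<ge> 1 * l" using l0 by (intro mult_right_mono) auto
  hence "(5 + 2 * B) * l \<le> (5 + 2 * B) * l\<^sup>2" using B by (intro mult_left_mono) (auto simp: power2_eq_square)
  hence n': "(5 + 2 * B) * l \<le> real n" using n by linarith
  have delta: "\<delta> \<le> 2 * exp (- 4 * pi * l)"
  proof -
    have "5 * l\<^sup>2 \<le> (5 + 2 * B) * l\<^sup>2" using B by (intro mult_right_mono) auto
    hence "5 * l \<le> real n / l" using n l0 by (simp add: field_simps power2_eq_square)
    hence "pi * (5 * l) \<le> pi * (real n / l)" by (intro mult_left_mono) auto
    hence "q ^ n \<le> exp (- 5 * pi * l)"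
      by (simp add: q exp_of_nat_mult[symmetric] mult_ac)
    moreover have "1 / (1 - q) \<le> exp (pi * l)"
      unfolding q by (rule inverse_one_minus_exp_le[OF l0(1)])
    ultimately have "q ^ n * (1 / (1 - q)) \<le> exp (- 5 * pi * l) * exp (pi * l)"
      using q01 by (intro mult_mono) auto
    also have "\<dots> = exp (- 4 * pi * l)" by (simp add: exp_add[symmetric] algebra_simps)
    finally show ?thesis by (simp add: \<delta>_def)
  qed
  have "\<delta> \<ge> 0" using q01 by (simp add: \<delta>_def)
  have "\<delta> * Re (theta_sum l v 0) \<le> 2 * exp (- 4 * pi * l) * (3 * W)"
  proof (rule order_trans[OF mult_left_mono mult_right_mono])
    show "Re (theta_sum l v 0) \<le> 3 * W" unfolding W_def by (rule theta_sum_0_le[OF l0(2)])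
  qed (use delta W \<open>\<delta> \<ge> 0\<close> in auto)
  moreover have "exp (- 2 * pi * real n) * Re (theta_sum l (v - 1) 0) \<le> exp (- 4 * pi * l) * (3 * W)"
  proof -
    have "exp (- 2 * pi * real n) * Re (theta_sum l (v - 1) 0)
        \<le> exp (- 2 * pi * real n) * (3 * (sqrt l * exp (pi * l * (v - 1)\<^sup>2)))"
      by (intro mult_left_mono theta_sum_0_le[OF l0(2)]) auto
    also have "\<dots> = 3 * W * exp (- 2 * pi * real n + pi * l * (1 - 2 * v))"
      by (simp add: W_def exp_add[symmetric] power2_eq_square algebra_simps)
    also have "\<dots> \<le> 3 * W * exp (- 4 * pi * l)"
    proof -
      have "l * (1 - 2 * v) \<le> l * (1 + 2 * B)" using v l0 by (intro mult_left_mono) auto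
      hence "l * (1 - 2 * v) + 4 * l \<le> (5 + 2 * B) * l" by (simp add: algebra_simps)
      hence "l * (1 - 2 * v) + 4 * l \<le> 2 * real n" using n' by linarith
      hence "pi * (l * (1 - 2 * v) + 4 * l) \<le> pi * (2 * real n)" by (intro mult_left_mono) auto
      thus ?thesis using W by (simp add: algebra_simps)
    qed
    finally show ?thesis by (simp add: mult_ac)
  qed
  ultimately have "norm (S - theta_sum l v t) \<le> W * (9 * exp (- 4 * pi * l))"
    using bound by (simp add: algebra_simps)
  with S that show ?thesis by (simp add: W_def)
qed

text \<open>
  Splits \<open>\<kappa> (S/W) - c0\<close> as \<open>\<kappa> (S/W - c0) + (\<kappa> - 1) c0\<close>, with \<open>\<bar>\<kappa>\<bar> \<le> 7/2\<close>.
\<close>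

lemma relative_error_combine:
  fixes S W c0 :: complex and \<kappa> r \<epsilon> h :: real
  assumes S: "norm (S - W * c0) \<le> norm W * r" and W: "W \<noteq> 0" and c0: "norm c0 \<le> 1"
    and k: "\<bar>\<kappa> - 1\<bar> \<le> \<epsilon>" "\<epsilon> \<le> 5/2"
  shows "norm (of_real \<kappa> * (S / W) - c0) \<le> 7/2 * r + \<epsilon>"
proof -
  have "norm (S / W - c0) = norm (S - W * c0) / norm W"
    using W by (simp add: norm_divide[symmetric] diff_divide_distrib)
  also have "\<dots> \<le> r" using S W by (simp add: field_simps)
  finally have r: "norm (S / W - c0) \<le> r" .
  have "of_real \<kappa> * (S / W) - c0 = of_real \<kappa> * (S / W - c0) + of_real (\<kappa> - 1) * c0"
    by (simp add: algebra_simps)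
  also have "norm \<dots> \<le> \<bar>\<kappa>\<bar> * norm (S / W - c0) + \<bar>\<kappa> - 1\<bar> * norm c0"
    by (rule order_trans[OF norm_triangle_ineq]) (simp only: norm_mult norm_of_real order_refl)
  also have "\<dots> \<le> 7/2 * r + \<epsilon> * 1"
    using k c0 r by (intro add_mono mult_mono) auto
  finally show ?thesis by simp
qed

text \<open>
  The common part of both formulas: \<open>W c0\<close> is the leading behaviour of the theta series, \<open>c D\<close> the
  prefactor of the asymptotic formula, and the hypothesis on \<open>D\<close> says that the two fit together once
  \<open>(q;q)\<^sub>\<infinity>\<close> is replaced by its leading term.
\<close>

lemma q_bessel2_relative_error:
  fixes l \<nu> v t q L W D r :: real and n :: nat and \<iota> c c0 S :: complex
  assumes l: "l \<ge> 3/2" and nu: "\<nu> > -1" and q: "q = exp (- pi / l)"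
    and L: "L = pi * v + pi * \<nu> / (2 * l) + 2 * pi * real n / l"
    and iota: "\<iota> \<noteq> 0" "\<And>k. (-1) ^ k * \<iota> powr of_real (2 * real k + \<nu>) = c * cis (2 * pi * (real k - 2 * real n) * t)"
    and S: "(\<lambda>k. of_real (bessel_weight \<nu> q k * exp (- pi * (real k - 2 * real n)\<^sup>2 / l + 2 * pi * v * (real k - 2 * real n)))
        * cis (2 * pi * (real k - 2 * real n) * t)) sums S"
    and W: "W > 0" and SW: "norm (S - of_real W * c0) \<le> W * r"
    and c: "c \<noteq> 0" and c0: "norm c0 \<le> 1" and D: "D > 0"
      "D * (2 * l * exp (pi / (12 * l) - pi * l / 3)) =
         exp (\<nu> * L + 4 * pi * (real n)\<^sup>2 / l + 4 * pi * v * real n) * W"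
  shows "norm (q_bessel2 \<nu> (2 * \<iota> * of_real (exp L)) q / (c * of_real D) - c0) \<le> 7/2 * r + 40 * exp (- 4 * pi * l)"
proof -
  have l0: "l > 0" "l \<ge> 1" using l by auto
  define Q where "Q = real_qpoch_inf q q"
  have Q: "Q > 0" unfolding Q_def using l0 by (intro real_qpoch_inf_pos) (auto simp: q)
  define M where "M = exp (\<nu> * L + 4 * pi * (real n)\<^sup>2 / l + 4 * pi * v * real n)"
  define \<kappa> where "\<kappa> = 2 * l * exp (pi / (12 * l) - pi * l / 3) / Q\<^sup>2"
  have "D * \<kappa> = M * W / Q\<^sup>2" using D(2) by (simp add: \<kappa>_def M_def)
  hence "M / Q\<^sup>2 / D = \<kappa> / W" using D(1) W Q by (simp add: field_simps)
  moreover have "q_bessel2 \<nu> (2 * \<iota> * of_real (exp L)) q = c * of_real (M / Q\<^sup>2) * S"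
    using q_bessel2_eq_truncated_theta[OF l0(1) nu q L iota S] by (simp add: M_def Q_def)
  hence "q_bessel2 \<nu> (2 * \<iota> * of_real (exp L)) q / (c * of_real D) = of_real (M / Q\<^sup>2 / D) * S"
    using c by simp
  ultimately have J: "q_bessel2 \<nu> (2 * \<iota> * of_real (exp L)) q / (c * of_real D) = of_real \<kappa> * (S / of_real W)"
    by simp
  show ?thesis unfolding J
  proof (rule relative_error_combine)
    show "\<bar>\<kappa> - 1\<bar> \<le> 40 * exp (- 4 * pi * l)"
      unfolding \<kappa>_def Q_def by (rule inverse_euler_function_square_approx[OF l q])
    show "40 * exp (- 4 * pi * l) \<le> 5/2" using exp_minus_4pi_le[OF l0(2)] by simp
  qed (use SW W c0 in auto)
qed

text \<open>
  The identity of exponents behind the square \<open>(v + (4 n + \<nu>) / (2 l))\<^sup>2\<close>. The free parameter \<open>u\<close> is the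
  growth rate, \<open>\<pi> l / 3\<close> in the first formula and \<open>\<pi> l / 12\<close> in the second.
\<close>

lemma bessel_prefactor:
  fixes l \<nu> v L u n :: real
  assumes l: "l > 0" and L: "L = pi * v + pi * \<nu> / (2 * l) + 2 * pi * n / l"
  shows "exp (u - pi / (12 * l) + \<nu>\<^sup>2 * pi / (4 * l)) * exp (pi * l * (v + (4 * n + \<nu>) / (2 * l))\<^sup>2)
       * exp (pi / (12 * l) - pi * l / 3)
     = exp (\<nu> * L + 4 * pi * n\<^sup>2 / l + 4 * pi * v * n) * (exp (pi * l * v\<^sup>2) * exp (u - pi * l / 3))"
proof -
  have "(u - pi / (12 * l) + \<nu>\<^sup>2 * pi / (4 * l)) + pi * l * (v + (4 * n + \<nu>) / (2 * l))\<^sup>2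
       + (pi / (12 * l) - pi * l / 3) =
     (\<nu> * L + 4 * pi * n\<^sup>2 / l + 4 * pi * v * n) + (pi * l * v\<^sup>2 + (u - pi * l / 3))"
    using l by (simp add: L field_simps power2_eq_square)
  thus ?thesis by (simp only: exp_add[symmetric])
qed

text \<open>
  The leading term of the theta series is \<open>1\<close>; the error \<open>exp (- \<pi> l)\<close> comes from its neighbours
  \<open>m = \<plusminus>1\<close> and dominates all others.
\<close>

lemma q_bessel2_imaginary_asymptotic:
  fixes l \<nu> v q B L :: real and n :: nat
  assumes l: "l \<ge> 3/2" and nu: "\<nu> > -1" and q: "q = exp (- pi / l)"
    and v: "\<bar>v\<bar> \<le> B" and n: "(5 + 2 * B) * l\<^sup>2 \<le> real n"
    and L: "L = pi * v + pi * \<nu> / (2 * l) + 2 * pi * real n / l"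
  shows "norm (q_bessel2 \<nu> (2 * \<i> * of_real (exp L)) q /
      (exp (of_real (pi * l / 3 - pi / (12 * l) + \<nu>\<^sup>2 * pi / (4 * l)) + of_real (\<nu> * pi / 2) * \<i>) / of_real (2 * sqrt l)
         * of_real (exp (pi * l * (v + (4 * real n + \<nu>) / (2 * l))\<^sup>2))) - 1) \<le> 86 * exp (- pi * l)"
proof -
  have l0: "l > 0" "l \<ge> 1" using l by auto
  have exp_le: "exp (- 4 * pi * l) \<le> exp (- pi * l)" using l0 by simp
  define W where "W = sqrt l * exp (pi * l * v\<^sup>2)"
  have W: "W > 0" using l0 by (simp add: W_def)
  define c where "c = exp (of_real (\<nu> * pi / 2) * \<i>)"
  obtain S where S: "(\<lambda>k. of_real (bessel_weight \<nu> q k * exp (- pi * (real k - 2 * real n)\<^sup>2 / l + 2 * pi * v * (real k - 2 * real n)))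
        * cis (2 * pi * (real k - 2 * real n) * 0)) sums S"
    and SW: "norm (S - theta_sum l v 0) \<le> W * (9 * exp (- 4 * pi * l))"
    unfolding W_def by (rule bessel_sum_approx[OF l nu q v n])
  have iota: "(-1) ^ k * \<i> powr of_real (2 * real k + \<nu>) = c * cis (2 * pi * (real k - 2 * real n) * 0)" for k
  proof -
    have "\<i> powr of_real (2 * real k + \<nu>) = exp (of_real (\<nu> * pi / 2) * \<i> + of_nat k * (of_real pi * \<i>))"
      by (simp add: powr_def algebra_simps)
    also have "\<dots> = c * (-1) ^ k"
      unfolding exp_add exp_of_nat_mult c_def by simp
    finally show ?thesis by (simp add: mult_ac power_mult_distrib[symmetric])
  qed
  define D where "D = exp (pi * l / 3 - pi / (12 * l) + \<nu>\<^sup>2 * pi / (4 * l)) / (2 * sqrt l)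
         * exp (pi * l * (v + (4 * real n + \<nu>) / (2 * l))\<^sup>2)"
  have "norm (S - of_real W * 1) \<le> W * (13 * exp (- pi * l))"
  proof -
    have "norm (S - of_real W) \<le> norm (S - theta_sum l v 0) + norm (theta_sum l v 0 - of_real W)"
      using norm_triangle_ineq[of "S - theta_sum l v 0" "theta_sum l v 0 - of_real W"] by simp
    also have "\<dots> \<le> W * (9 * exp (- 4 * pi * l)) + W * (4 * exp (- pi * l))"
      using SW theta_sum_0_approx[OF l0(2), of v] unfolding W_def by (intro add_mono) auto
    also have "\<dots> \<le> W * (9 * exp (- pi * l)) + W * (4 * exp (- pi * l))"
      using W exp_le by (intro add_mono mult_left_mono) auto
    finally show ?thesis by (simp add: algebra_simps)
  qed
  moreover have "D * (2 * l * exp (pi / (12 * l) - pi * l / 3)) =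
      exp (\<nu> * L + 4 * pi * (real n)\<^sup>2 / l + 4 * pi * v * real n) * W"
  proof -
    have "D * (2 * l * exp (pi / (12 * l) - pi * l / 3)) = (l / sqrt l) *
       (exp (pi * l / 3 - pi / (12 * l) + \<nu>\<^sup>2 * pi / (4 * l)) * exp (pi * l * (v + (4 * real n + \<nu>) / (2 * l))\<^sup>2)
       * exp (pi / (12 * l) - pi * l / 3))"
      unfolding D_def by simp
    also have "l / sqrt l = sqrt l" using l0 by (simp add: real_div_sqrt)
    finally show ?thesis unfolding bessel_prefactor[OF l0(1) L] W_def by simp
  qed
  moreover have "c \<noteq> 0" "D > 0" using l0 by (auto simp: c_def D_def)
  ultimately have "norm (q_bessel2 \<nu> (2 * \<i> * of_real (exp L)) q / (c * of_real D) - 1)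
      \<le> 7/2 * (13 * exp (- pi * l)) + 40 * exp (- 4 * pi * l)"
    using W by (intro q_bessel2_relative_error[OF l nu q L _ iota S]) auto
  also have "\<dots> \<le> 86 * exp (- pi * l)"
    using exp_le exp_gt_zero[of "- pi * l"] by linarith
  also have "c * of_real D = exp (of_real (pi * l / 3 - pi / (12 * l) + \<nu>\<^sup>2 * pi / (4 * l)) + of_real (\<nu> * pi / 2) * \<i>) / of_real (2 * sqrt l)
         * of_real (exp (pi * l * (v + (4 * real n + \<nu>) / (2 * l))\<^sup>2))"
    unfolding exp_add exp_of_real c_def D_def by simp
  finally show ?thesis .
qed

text \<open>
  Relative to the alternating theta series of size \<open>exp (- \<pi> l / 4)\<close>, the half-integers \<open>\<plusminus>3/2\<close> have size
  \<open>exp (- 2 \<pi> l)\<close>. The truncation error \<open>exp (- 4 \<pi> l)\<close> stays below this also after division by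
  \<open>exp (- \<pi> l / 4)\<close>. As the cosine may vanish, the error is additive and not relative.
\<close>

lemma q_bessel2_real_asymptotic:
  fixes l \<nu> v q B L :: real and n :: nat
  assumes l: "l \<ge> 3/2" and nu: "\<nu> > -1" and q: "q = exp (- pi / l)"
    and v: "\<bar>v\<bar> \<le> B" and n: "(5 + 2 * B) * l\<^sup>2 \<le> real n"
    and L: "L = pi * v + pi * \<nu> / (2 * l) + 2 * pi * real n / l"
  shows "norm (q_bessel2 \<nu> (of_real (2 * exp L)) q /
      (of_real (exp (pi * l / 12 - pi / (12 * l) + \<nu>\<^sup>2 * pi / (4 * l)) / sqrt l)
         * of_real (exp (pi * l * (v + (4 * real n + \<nu>) / (2 * l))\<^sup>2))) - of_real (cos (pi * l * v)))
    \<le> 65 * exp (- 2 * pi * l)"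
proof -
  have l0: "l > 0" "l \<ge> 1" using l by auto
  define W0 where "W0 = sqrt l * exp (pi * l * v\<^sup>2)"
  define W where "W = 2 * W0 * exp (- pi * l / 4)"
  have W: "W0 > 0" "W > 0" using l0 by (auto simp: W_def W0_def)
  obtain S where S: "(\<lambda>k. of_real (bessel_weight \<nu> q k * exp (- pi * (real k - 2 * real n)\<^sup>2 / l + 2 * pi * v * (real k - 2 * real n)))
        * cis (2 * pi * (real k - 2 * real n) * (1/2))) sums S"
    and SW: "norm (S - theta_sum l v (1/2)) \<le> W0 * (9 * exp (- 4 * pi * l))"
    unfolding W0_def by (rule bessel_sum_approx[OF l nu q v n])
  have iota: "(-1) ^ k * 1 powr of_real (2 * real k + \<nu>) = 1 * cis (2 * pi * (real k - 2 * real n) * (1/2))" for k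
  proof -
    \<comment> \<open>The shift of the index by the even number 2n does not change the sign.\<close>
    have "2 * pi * (real k - 2 * real n) * (1/2) = real k * pi + 2 * pi * (- real n)" by (simp add: algebra_simps)
    hence "cis (2 * pi * (real k - 2 * real n) * (1/2)) = cis (real k * pi) * cis (2 * pi * (- real n))"
      by (simp only: cis_mult)
    also have "cis (2 * pi * (- real n)) = 1" by (rule cis_multiple_2pi) simp
    also have "cis (real k * pi) = (-1) ^ k" by (subst Complex.DeMoivre[symmetric]) simp
    finally show ?thesis by simp
  qed
  define D where "D = exp (pi * l / 12 - pi / (12 * l) + \<nu>\<^sup>2 * pi / (4 * l)) / sqrt l
         * exp (pi * l * (v + (4 * real n + \<nu>) / (2 * l))\<^sup>2)"
  have "norm (S - of_real W * of_real (cos (pi * l * v))) \<le> W * (7 * exp (- 2 * pi * l))"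
  proof -
    define T where "T = theta_sum l v (1/2)"
    have "{- int 1..int 1 - 1} = {-1, 0}" by auto
    hence "(\<Sum>m=- int 1..int 1 - 1. of_real (exp (- pi * l * (1/2 + of_int m)\<^sup>2)) * cis (2 * pi * (l * v) * (1/2 + of_int m)))
        = complex_of_real (2 * exp (- pi * l / 4) * cos (pi * l * v))"
      by (simp add: complex_eq_iff power2_eq_square mult_ac)
    hence "norm (T - of_real W0 * of_real (2 * exp (- pi * l / 4) * cos (pi * l * v)))
        \<le> W0 * (4 * (exp (- pi * l / 4) * exp (- pi * l * (real 1 * (real 1 + 1)))))"
      using theta_sum_half_approx[OF l0(2), of v 1] unfolding W0_def T_def by (simp only:)
    also have "\<dots> = W * (2 * exp (- 2 * pi * l))"
      by (simp add: W_def mult_ac)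
    also have "of_real W0 * of_real (2 * exp (- pi * l / 4) * cos (pi * l * v)) = of_real W * complex_of_real (cos (pi * l * v))"
      by (simp add: W_def)
    finally have "norm (T - of_real W * of_real (cos (pi * l * v))) \<le> W * (2 * exp (- 2 * pi * l))" .
    moreover have "W0 * (9 * exp (- 4 * pi * l)) \<le> W * (9/2 * exp (- 2 * pi * l))"
    proof -
      have "exp (- 4 * pi * l) \<le> exp (- pi * l / 4 - 2 * pi * l)" using l0 by simp
      hence "W0 * 9 * exp (- 4 * pi * l) \<le> W0 * 9 * exp (- pi * l / 4 - 2 * pi * l)"
        using W by (intro mult_left_mono) auto
      also have "\<dots> = W * (9/2 * exp (- 2 * pi * l))"
      proof -
        have "exp (- pi * l / 4 - 2 * pi * l) = exp (- pi * l / 4) * exp (- 2 * pi * l)"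
          by (simp add: exp_add[symmetric])
        thus ?thesis by (simp add: W_def)
      qed
      finally show ?thesis by (simp add: mult_ac)
    qed
    moreover have "norm (S - of_real W * of_real (cos (pi * l * v))) \<le> norm (S - T) + norm (T - of_real W * of_real (cos (pi * l * v)))"
      using norm_triangle_ineq[of "S - T" "T - of_real W * of_real (cos (pi * l * v))"] by simp
    moreover have "W * exp (- 2 * pi * l) \<ge> 0" using W by simp
    ultimately show ?thesis using SW unfolding T_def by (simp add: algebra_simps)
  qed
  moreover have "D * (2 * l * exp (pi / (12 * l) - pi * l / 3)) =
      exp (\<nu> * L + 4 * pi * (real n)\<^sup>2 / l + 4 * pi * v * real n) * W"
  proof -
    have "D * (2 * l * exp (pi / (12 * l) - pi * l / 3)) = 2 * (l / sqrt l) *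
       (exp (pi * l / 12 - pi / (12 * l) + \<nu>\<^sup>2 * pi / (4 * l)) * exp (pi * l * (v + (4 * real n + \<nu>) / (2 * l))\<^sup>2)
       * exp (pi / (12 * l) - pi * l / 3))"
      unfolding D_def by simp
    also have "l / sqrt l = sqrt l" using l0 by (simp add: real_div_sqrt)
    finally show ?thesis unfolding bessel_prefactor[OF l0(1) L] W_def W0_def by simp
  qed
  moreover have "D > 0" using l0 by (auto simp: D_def)
  ultimately have "norm (q_bessel2 \<nu> (2 * 1 * of_real (exp L)) q / (1 * of_real D) - of_real (cos (pi * l * v)))
      \<le> 7/2 * (7 * exp (- 2 * pi * l)) + 40 * exp (- 4 * pi * l)"
    using W by (intro q_bessel2_relative_error[OF l nu q L _ iota S]) auto
  also have "\<dots> \<le> 65 * exp (- 2 * pi * l)"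
  proof -
    have "exp (- 4 * pi * l) \<le> exp (- 2 * pi * l)" using l0 by simp
    thus ?thesis using exp_gt_zero[of "- 2 * pi * l"] by linarith
  qed
  finally show ?thesis by (simp add: D_def)
qed

lemma admissible_scale_eventually:
  assumes "admissible_scale lam"
  shows "\<forall>\<^sub>F n in sequentially. 3/2 \<le> lam n \<and> M * (lam n)\<^sup>2 \<le> real n"
proof -
  have pos: "lam n > 0" if "n \<ge> 1" for n using assms that by (simp add: admissible_scale_def)
  have "\<forall>\<^sub>F n in sequentially. 3/2 \<le> lam n / ln (real n)" "\<forall>\<^sub>F n in sequentially. M \<le> real n / (lam n)\<^sup>2"
    using assms unfolding admissible_scale_def filterlim_at_top by blast+
  thus ?thesis using eventually_ge_at_top[of 3]
  proof eventually_elim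
    case (elim n)
    have "exp 1 \<le> (3::real)" by (rule exp_le)
    hence ln: "ln (real n) \<ge> 1" using elim(3) by (subst ln_ge_iff) auto
    have "3/2 * 1 \<le> 3/2 * ln (real n)" using ln by simp
    also have "\<dots> \<le> lam n" using elim(1) ln by (simp add: field_simps)
    finally show ?case using elim pos[of n] by (simp add: field_simps)
  qed
qed

theorem corollary3p4:
  fixes lam :: "nat \<Rightarrow> real" and \<nu> :: real
    and z :: "real \<Rightarrow> real" and q :: "nat \<Rightarrow> real"
  assumes lam: "admissible_scale lam"
    and nu: "\<nu> > -1"
    and z: "\<And>v. z v = exp (2 * pi * v)"
    and q: "\<And>n. q n = exp (- pi / lam n)"
  shows "(\<exists>E :: nat \<Rightarrow> real \<Rightarrow> complex.
      (\<forall>n\<ge>1. \<forall>v.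
         q_bessel2 \<nu>
           (2 * \<i> * of_real (sqrt (z v * q n powr (- \<nu>)) * q n powr (- 2 * real n))) (q n) =
         exp (of_real (pi * lam n / 3 - pi / (12 * lam n) + \<nu>\<^sup>2 * pi / (4 * lam n))
              + of_real (\<nu> * pi / 2) * \<i>)
           / of_real (2 * sqrt (lam n))
         * of_real (exp (pi * lam n * (v + (4 * real n + \<nu>) / (2 * lam n))\<^sup>2))
         * (1 + E n v)) \<and>
      (\<forall>K. compact K \<longrightarrow>
         (\<exists>C. \<forall>\<^sub>F n in sequentially. \<forall>v\<in>K. norm (E n v) \<le> C * exp (- pi * lam n)))) \<and>
    (\<exists>E :: nat \<Rightarrow> real \<Rightarrow> complex.
      (\<forall>n\<ge>1. \<forall>v.
         q_bessel2 \<nu>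
           (of_real (2 * sqrt (z v * q n powr (- \<nu>)) * q n powr (- 2 * real n))) (q n) =
         of_real (exp (pi * lam n / 12 - pi / (12 * lam n) + \<nu>\<^sup>2 * pi / (4 * lam n))
                  / sqrt (lam n))
         * of_real (exp (pi * lam n * (v + (4 * real n + \<nu>) / (2 * lam n))\<^sup>2))
         * (of_real (cos (pi * lam n * v)) + E n v)) \<and>
      (\<forall>K. compact K \<longrightarrow>
         (\<exists>C. \<forall>\<^sub>F n in sequentially. \<forall>v\<in>K. norm (E n v) \<le> C * exp (- 2 * pi * lam n))))"
proof -
  define L where "L = (\<lambda>n v. pi * v + pi * \<nu> / (2 * lam n) + 2 * pi * real n / lam n)"
  have pos: "lam n > 0" if "n \<ge> 1" for n using lam that by (simp add: admissible_scale_def)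
  have arg: "sqrt (z v * q n powr (- \<nu>)) * q n powr (- 2 * real n) = exp (L n v)" for n v
  proof -
    have "z v * q n powr (- \<nu>) = (exp (pi * v + pi * \<nu> / (2 * lam n)))\<^sup>2"
      by (simp add: z q exp_powr_real exp_add[symmetric] exp_double[symmetric] algebra_simps)
    hence "sqrt (z v * q n powr (- \<nu>)) = exp (pi * v + pi * \<nu> / (2 * lam n))" by simp
    moreover have "q n powr (- 2 * real n) = exp (2 * pi * real n / lam n)"
      by (simp add: q exp_powr_real algebra_simps)
    ultimately show ?thesis by (simp add: L_def exp_add)
  qed
  have arg2: "2 * sqrt (z v * q n powr (- \<nu>)) * q n powr (- 2 * real n) = 2 * exp (L n v)" for n v
    using arg[of v n] by simp
  \<comment> \<open>The error terms are defined by solving the two equations for them, which is possible as the prefactors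
    do not vanish for \<open>n \<ge> 1\<close>; only the bounds need proof.\<close>
  define J1 where "J1 = (\<lambda>n v. q_bessel2 \<nu> (2 * \<i> * of_real (exp (L n v))) (q n))"
  define J2 where "J2 = (\<lambda>n v. q_bessel2 \<nu> (of_real (2 * exp (L n v))) (q n))"
  define D1 where "D1 = (\<lambda>n v. exp (of_real (pi * lam n / 3 - pi / (12 * lam n) + \<nu>\<^sup>2 * pi / (4 * lam n))
              + of_real (\<nu> * pi / 2) * \<i>) / of_real (2 * sqrt (lam n))
         * of_real (exp (pi * lam n * (v + (4 * real n + \<nu>) / (2 * lam n))\<^sup>2)))"
  define D2 where "D2 = (\<lambda>n v. complex_of_real (exp (pi * lam n / 12 - pi / (12 * lam n) + \<nu>\<^sup>2 * pi / (4 * lam n))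
                  / sqrt (lam n))
         * of_real (exp (pi * lam n * (v + (4 * real n + \<nu>) / (2 * lam n))\<^sup>2)))"
  have D_nz: "D1 n v \<noteq> 0" "D2 n v \<noteq> 0" if "n \<ge> 1" for n v
    using pos[OF that] by (auto simp: D1_def D2_def)
  have ev: "\<exists>B. \<forall>\<^sub>F n in sequentially. \<forall>v\<in>K.
      3/2 \<le> lam n \<and> \<bar>v\<bar> \<le> B \<and> (5 + 2 * B) * (lam n)\<^sup>2 \<le> real n" if K: "compact K" for K :: "real set"
  proof -
    obtain B where B: "\<forall>v\<in>K. \<bar>v\<bar> \<le> B"
      using compact_imp_bounded[OF K] unfolding bounded_iff real_norm_def by blast
    show ?thesis
    proof (intro exI[of _ B])
      show "\<forall>\<^sub>F n in sequentially. \<forall>v\<in>K. 3/2 \<le> lam n \<and> \<bar>v\<bar> \<le> B \<and> (5 + 2 * B) * (lam n)\<^sup>2 \<le> real n"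
        using admissible_scale_eventually[OF lam, of "5 + 2 * B"] by eventually_elim (use B in blast)
    qed
  qed
  have E1: "\<exists>C. \<forall>\<^sub>F n in sequentially. \<forall>v\<in>K. norm (J1 n v / D1 n v - 1) \<le> C * exp (- pi * lam n)"
    if K: "compact K" for K
  proof -
    obtain B where "\<forall>\<^sub>F n in sequentially. \<forall>v\<in>K.
      3/2 \<le> lam n \<and> \<bar>v\<bar> \<le> B \<and> (5 + 2 * B) * (lam n)\<^sup>2 \<le> real n" using ev[OF K] by blast
    hence "\<forall>\<^sub>F n in sequentially. \<forall>v\<in>K. norm (J1 n v / D1 n v - 1) \<le> 86 * exp (- pi * lam n)"
    proof eventually_elim
      case (elim n)
      show ?case
      proof
        fix v assume "v \<in> K"
        with elim show "norm (J1 n v / D1 n v - 1) \<le> 86 * exp (- pi * lam n)"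
          unfolding J1_def D1_def
          by (intro q_bessel2_imaginary_asymptotic[where B = B] nu q L_def[THEN fun_cong, THEN fun_cong]) auto
      qed
    qed
    thus ?thesis by blast
  qed
  have E2: "\<exists>C. \<forall>\<^sub>F n in sequentially. \<forall>v\<in>K.
      norm (J2 n v / D2 n v - of_real (cos (pi * lam n * v))) \<le> C * exp (- 2 * pi * lam n)"
    if K: "compact K" for K
  proof -
    obtain B where "\<forall>\<^sub>F n in sequentially. \<forall>v\<in>K.
      3/2 \<le> lam n \<and> \<bar>v\<bar> \<le> B \<and> (5 + 2 * B) * (lam n)\<^sup>2 \<le> real n" using ev[OF K] by blast
    hence "\<forall>\<^sub>F n in sequentially. \<forall>v\<in>K.
        norm (J2 n v / D2 n v - of_real (cos (pi * lam n * v))) \<le> 65 * exp (- 2 * pi * lam n)"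
    proof eventually_elim
      case (elim n)
      show ?case
      proof
        fix v assume "v \<in> K"
        with elim show "norm (J2 n v / D2 n v - of_real (cos (pi * lam n * v))) \<le> 65 * exp (- 2 * pi * lam n)"
          unfolding J2_def D2_def
          by (intro q_bessel2_real_asymptotic[where B = B] nu q L_def[THEN fun_cong, THEN fun_cong]) auto
      qed
    qed
    thus ?thesis by blast
  qed
  have "\<exists>E. (\<forall>n\<ge>1. \<forall>v. J1 n v = D1 n v * (1 + E n v)) \<and>
      (\<forall>K. compact K \<longrightarrow> (\<exists>C. \<forall>\<^sub>F n in sequentially. \<forall>v\<in>K. norm (E n v) \<le> C * exp (- pi * lam n)))"
    by (rule exI[of _ "\<lambda>n v. J1 n v / D1 n v - 1"]) (use E1 D_nz in simp)
  moreover have "\<exists>E. (\<forall>n\<ge>1. \<forall>v. J2 n v = D2 n v * (of_real (cos (pi * lam n * v)) + E n v)) \<and>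
      (\<forall>K. compact K \<longrightarrow> (\<exists>C. \<forall>\<^sub>F n in sequentially. \<forall>v\<in>K. norm (E n v) \<le> C * exp (- 2 * pi * lam n)))"
    by (rule exI[of _ "\<lambda>n v. J2 n v / D2 n v - of_real (cos (pi * lam n * v))"]) (use E2 D_nz in simp)
  ultimately show ?thesis
    unfolding J1_def J2_def D1_def D2_def arg arg2 by (rule conjI)
qed

end
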